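(* Fix $d\in\mathbb{N}$, $r\in\mathbb{N}\cup\{0\}$, and $\nu>0$. Then there exists a constant $\kappa_{r,d}>0$ (depending only on $r$ and $d$) such that $$R_n(\mathcal{M}_{\tau_{r,d},\nu})\ge\kappa_{r,d}\,\nu^d\,\frac{(\log n)^d}{n}$$ for all sufficiently large $n$.
   Context: For $r\in\mathbb{N}\cup\{0\}$, $$\tau_r(x)=\frac{\Gamma(r+1)}{\sqrt\pi\,\Gamma(r+\frac12)}(1+x^2)^{-r-1},\qquad x\in\mathbb{R},$$ a rescaled Student-$t$ density with $2r+1$ degrees of freedom ($\Gamma$ is the Gamma function), and $\tau_{r,d}(x)=\prod_{k=1}^d\tau_r(x_k)$ for $x=(x_1,\dots,x_d)\in\mathbb{R}^d$. For a density $\varphi$ on $\mathbb{R}^d$ and $\nu>0$, $\varphi_\nu(x)=\nu^d\varphi(\nu x)$, and $\mathcal{M}_{\varphi,\nu}$ is the class of functions $x\mapsto\int_{\mathbb{R}^d}\varphi_\nu(x-\mu)\,G(d\mu)$, where $G$ ranges over all probability measures on $\mathbb{R}^d$. For a class $\mathcal{F}$ of square-integrable probability densities on $\mathbb{R}^d$, the squared $\mathcal{L}_2$ minimax risk is $$R_n(\mathcal{F})=\inf_{\tilde f_n}\sup_{f_0\in\mathcal{F}}\mathrm{E}_{f_0}\|\tilde f_n-f_0\|_2^2,$$ where $\tilde f_n$ ranges over all measurable estimators based on $n$ i.i.d. observations with density $f_0$, with the convention that the loss is infinite whenever $\tilde f_n$ is not $\mathcal{L}_2$-valued. *)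

theory Defs
  imports "HOL-Probability.Probability"
begin

definition student :: "nat \<Rightarrow> real \<Rightarrow> real" where
  "student r x =
     Gamma (real r + 1) / (sqrt pi * Gamma (real r + 1/2)) * (1 + x\<^sup>2) powi (- int r - 1)"

definition student_prod :: "nat \<Rightarrow> real ^ 'd \<Rightarrow> real" where
  "student_prod r x = (\<Prod>k\<in>UNIV. student r (x $ k))"

definition rescale :: "(real ^ 'd \<Rightarrow> real) \<Rightarrow> real \<Rightarrow> real ^ 'd \<Rightarrow> real" where
  "rescale \<phi> \<nu> x = \<nu> ^ CARD('d) * \<phi> (\<nu> *\<^sub>R x)"

definition location_mixture ::
  "(real ^ 'd \<Rightarrow> real) \<Rightarrow> real \<Rightarrow> (real ^ 'd) measure \<Rightarrow> real ^ 'd \<Rightarrow> real" where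
  "location_mixture \<phi> \<nu> G x = (\<integral>\<mu>. rescale \<phi> \<nu> (x - \<mu>) \<partial>G)"

definition mixture_class :: "(real ^ 'd \<Rightarrow> real) \<Rightarrow> real \<Rightarrow> (real ^ 'd \<Rightarrow> real) set" where
  "mixture_class \<phi> \<nu> =
     {location_mixture \<phi> \<nu> G | G. prob_space G \<and> sets G = sets borel}"

(* If f is square-integrable and g is measurable but not square-integrable, this integral is
   infinite, so the convention that the loss of such an estimate g is infinite is built in. *)
definition sq_L2_loss :: "(real ^ 'd \<Rightarrow> real) \<Rightarrow> (real ^ 'd \<Rightarrow> real) \<Rightarrow> ennreal" where
  "sq_L2_loss g f = (\<integral>\<^sup>+ x. ennreal ((g x - f x)\<^sup>2) \<partial>lborel)"

definition iid_law :: "nat \<Rightarrow> (real ^ 'd \<Rightarrow> real) \<Rightarrow> (nat \<Rightarrow> real ^ 'd) measure" where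
  "iid_law n f = (\<Pi>\<^sub>M i\<in>{..<n}. density lborel (\<lambda>x. ennreal (f x)))"

(* An estimate is any real function (not necessarily a density), jointly measurable in the
   sample X and the evaluation point x. *)
definition estimators :: "nat \<Rightarrow> ((nat \<Rightarrow> real ^ 'd) \<Rightarrow> real ^ 'd \<Rightarrow> real) set" where
  "estimators n =
     {T. (\<lambda>(X, x). T X x) \<in> borel_measurable ((\<Pi>\<^sub>M i\<in>{..<n}. borel) \<Otimes>\<^sub>M borel)}"

definition minimax_risk :: "nat \<Rightarrow> (real ^ 'd \<Rightarrow> real) set \<Rightarrow> ennreal" where
  "minimax_risk n F =
     (INF T\<in>estimators n. SUP f\<in>F. \<integral>\<^sup>+ X. sq_L2_loss (T X) f \<partial>iid_law n f)"

end

theory Submission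
  imports Defs "HOL-Complex_Analysis.Complex_Analysis"
begin

text \<open>
  Why the bound holds. Convolution with the Student kernel damps the frequency \<open>j\<close> by a factor
  of order \<open>j^r exp(- j)\<close>. In a mixture the damping can be compensated by the mixing measure: a
  perturbation of the mixing density at frequency \<open>j\<close> may have an amplitude of constant order, so
  as long as \<open>exp(- j)\<close> exceeds a suitable negative power of \<open>n\<close>, the mixture can be moved at
  frequency \<open>j\<close> by an amount of order \<open>n^(-1/2)\<close>, which \<open>n\<close> observations cannot detect. There
  are of order \<open>ln n\<close> such frequencies in each coordinate, hence of order \<open>(ln n)^d\<close> undetectable
  directions in dimension \<open>d\<close>, and each of them costs a squared error of order \<open>1/n\<close>.

  The lower bound over a hypercube of densities is \<open>hypercube_minimax_bound\<close>. It reads the estimate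
  only through its coefficients against an orthonormal system, here products of cosines on a cube.
  Flipping one coordinate of the hypercube moves the corresponding coefficient by a fixed amount, and
  Bessel's inequality adds up the errors, so the perturbations themselves may be far from orthogonal.

  Everything else factorises over the coordinates: \<open>tensor_minimax_bound\<close> reduces the
  problem to estimates on the real line, for a mixing density \<open>g\<close>, directions \<open>h j\<close> dominated by
  \<open>g\<close>, and the quotient between the signal, the coefficient of the convolved direction,
  and the noise, its chi-square norm.

  On the line \<open>g\<close> is the Cauchy density and \<open>h j\<close> is the real part of
  \<open>exp(\<i> j x) / (79 - \<i> x)^2\<close>, which is dominated by a multiple of \<open>g\<close> and extends
  holomorphically to the upper half-plane. The residue at the pole \<open>\<i>\<close>, of order \<open>r + 1\<close>,
  evaluates its convolution with the Student kernel exactly; the leading term for large \<open>j\<close> is a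
  constant times \<open>j^r exp(- j) exp(\<i> j x) / (80 - \<i> x)^2\<close> (\<open>smoothed_packet_asymptotics\<close>).
  Hence the signal is at least and the noise at most of the order \<open>j^r exp(- j)\<close>, and their
  quotient is bounded away from zero (\<open>one_dimensional_estimates\<close>). The frequencies used are
  those between \<open>m\<close> and \<open>2 m\<close> with \<open>m\<close> about \<open>ln n / (8 d)\<close>.
\<close>

section \<open>A hypercube lower bound for the L2 minimax risk\<close>

text \<open>
  Minimising the two squared errors over \<open>t\<close> leaves \<open>(a - b)^2 p q / (p + q)\<close>, and
  \<open>p q / (p + q)\<close> is at least \<open>sqrt (p q) - (p + q) / 4\<close> because
  \<open>(sqrt (p q) - (p + q) / 2)^2\<close> is nonnegative. Integrated over densities \<open>p\<close> and \<open>q\<close>, this is a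
  two-point bound that uses only their affinity.
\<close>

lemma two_point_pointwise:
  fixes p q t a b :: real
  assumes "p \<ge> 0" "q \<ge> 0"
  shows "(a - b)\<^sup>2 * sqrt (p * q) \<le> (t - a)\<^sup>2 * p + (t - b)\<^sup>2 * q + (a - b)\<^sup>2 / 4 * (p + q)"
proof (cases "p + q = 0")
  case True
  then show ?thesis using assms by (simp add: add_nonneg_eq_0_iff)
next
  case False
  then have pq: "p + q > 0" using assms by linarith
  have "(a - b)\<^sup>2 * (p * q) \<le> (p + q) * ((t - a)\<^sup>2 * p + (t - b)\<^sup>2 * q)"
  proof -
    have "(p + q) * ((t - a)\<^sup>2 * p + (t - b)\<^sup>2 * q) - (a - b)\<^sup>2 * (p * q)
        = (p * (t - a) + q * (t - b))\<^sup>2"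
      by (simp add: power2_eq_square algebra_simps)
    then show ?thesis by (smt (verit) zero_le_power2)
  qed
  then have 1: "(a - b)\<^sup>2 * (p * q / (p + q)) \<le> (t - a)\<^sup>2 * p + (t - b)\<^sup>2 * q"
    using pq by (simp add: field_simps)
  have "sqrt (p * q) * (p + q) \<le> p * q + (p + q)\<^sup>2 / 4"
  proof -
    have "0 \<le> (sqrt (p * q) - (p + q) / 2)\<^sup>2" by simp
    also have "\<dots> = p * q - sqrt (p * q) * (p + q) + (p + q)\<^sup>2 / 4"
      using assms by (simp add: power2_diff power_divide)
    finally show ?thesis by linarith
  qed
  then have "sqrt (p * q) \<le> (p * q + (p + q)\<^sup>2 / 4) / (p + q)"
    using pq by (simp add: pos_le_divide_eq)
  also have "\<dots> = p * q / (p + q) + (p + q) / 4"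
  proof -
    have "(c + s\<^sup>2 / 4) / s = c / s + s / 4" if "s > 0" for c s :: real
      using that by (simp add: field_simps power2_eq_square)
    from this[OF pq] show ?thesis .
  qed
  finally have "(a - b)\<^sup>2 * sqrt (p * q) \<le> (a - b)\<^sup>2 * (p * q / (p + q) + (p + q) / 4)"
    by (rule mult_left_mono) simp
  also have "\<dots> = (a - b)\<^sup>2 * (p * q / (p + q)) + (a - b)\<^sup>2 / 4 * (p + q)"
    by (simp add: algebra_simps)
  finally show ?thesis using 1 by linarith
qed

text \<open>
  Laws of samples from different densities have densities with respect to one and the same product
  of Lebesgue measures, so they can be compared pointwise.
\<close>

lemma iid_law_eq_density:
  fixes f :: "real ^ 'd \<Rightarrow> real"
  assumes [measurable]: "f \<in> borel_measurable borel" and nn: "\<And>x. f x \<ge> 0"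
    and one: "(\<integral>\<^sup>+x. ennreal (f x) \<partial>lborel) = 1"
  shows "iid_law n f = density (\<Pi>\<^sub>M i\<in>{..<n}. lborel) (\<lambda>X. ennreal (\<Prod>i<n. f (X i)))"
proof -
  let ?M = "density lborel (\<lambda>x. ennreal (f x))"
  interpret L: product_sigma_finite "\<lambda>_::nat. lborel :: (real ^ 'd) measure"
    by standard
  interpret D: prob_space ?M
    by (rule prob_spaceI) (simp add: emeasure_density one)
  interpret product_sigma_finite "\<lambda>_::nat. ?M" by standard
  show ?thesis unfolding iid_law_def
  proof (rule PiM_eqI[symmetric])
    show "sets (density (\<Pi>\<^sub>M i\<in>{..<n}. lborel) (\<lambda>X. ennreal (\<Prod>i<n. f (X i)))) = sets (\<Pi>\<^sub>M i\<in>{..<n}. ?M)"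
      by (simp cong: sets_PiM_cong)
    fix A assume "\<And>i. i \<in> {..<n} \<Longrightarrow> A i \<in> sets ?M"
    then have A[measurable]: "\<And>i. i \<in> {..<n} \<Longrightarrow> A i \<in> sets borel" by simp
    have "emeasure (density (\<Pi>\<^sub>M i\<in>{..<n}. lborel) (\<lambda>X. ennreal (\<Prod>i<n. f (X i)))) (Pi\<^sub>E {..<n} A)
      = (\<integral>\<^sup>+X. ennreal (\<Prod>i<n. f (X i)) * indicator (Pi\<^sub>E {..<n} A) X \<partial>(\<Pi>\<^sub>M i\<in>{..<n}. lborel))"
      by (rule emeasure_density) (auto intro!: sets_PiM_I_finite)
    also have "\<dots> = (\<integral>\<^sup>+X. (\<Prod>i<n. ennreal (f (X i)) * indicator (A i) (X i)) \<partial>(\<Pi>\<^sub>M i\<in>{..<n}. lborel))"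
    proof (rule nn_integral_cong)
      fix X :: "nat \<Rightarrow> real ^ 'd" assume X: "X \<in> space (\<Pi>\<^sub>M i\<in>{..<n}. lborel)"
      then have "X \<in> extensional {..<n}" by (auto simp: space_PiM PiE_def)
      then have "indicator (Pi\<^sub>E {..<n} A) X = (\<Prod>i<n. indicator (A i) (X i) :: ennreal)"
        by (auto simp: indicator_def PiE_def Pi_def prod_zero_iff)
      then show "ennreal (\<Prod>i<n. f (X i)) * indicator (Pi\<^sub>E {..<n} A) X
          = (\<Prod>i<n. ennreal (f (X i)) * indicator (A i) (X i))"
        by (simp add: prod.distrib prod_ennreal nn)
    qed
    also have "\<dots> = (\<Prod>i<n. \<integral>\<^sup>+x. ennreal (f x) * indicator (A i) x \<partial>lborel)"
      by (rule L.product_nn_integral_prod) auto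
    also have "\<dots> = (\<Prod>i<n. emeasure ?M (A i))"
      by (intro prod.cong refl) (simp add: emeasure_density)
    finally show "emeasure (density (\<Pi>\<^sub>M i\<in>{..<n}. lborel) (\<lambda>X. ennreal (\<Prod>i<n. f (X i)))) (Pi\<^sub>E {..<n} A)
      = (\<Prod>i<n. emeasure ?M (A i))" .
  qed simp
qed

lemma nn_integral_iid_law:
  fixes f :: "real ^ 'd \<Rightarrow> real"
  assumes [measurable]: "f \<in> borel_measurable borel" and nn: "\<And>x. f x \<ge> 0"
    and one: "(\<integral>\<^sup>+x. ennreal (f x) \<partial>lborel) = 1"
    and [measurable]: "g \<in> borel_measurable (\<Pi>\<^sub>M i\<in>{..<n}. lborel)"
  shows "(\<integral>\<^sup>+X. g X \<partial>iid_law n f)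
    = (\<integral>\<^sup>+X. ennreal (\<Prod>i<n. f (X i)) * g X \<partial>(\<Pi>\<^sub>M i\<in>{..<n}. lborel))"
  unfolding iid_law_eq_density[OF assms(1-3)] by (subst nn_integral_density) auto

lemma nn_integral_iid_product:
  fixes f :: "real ^ 'd \<Rightarrow> real"
  assumes [measurable]: "f \<in> borel_measurable borel" and nn: "\<And>x. f x \<ge> 0"
  shows "(\<integral>\<^sup>+X. ennreal (\<Prod>i<n. f (X i)) \<partial>(\<Pi>\<^sub>M i\<in>{..<n}. lborel))
    = (\<integral>\<^sup>+x. ennreal (f x) \<partial>lborel) ^ n"
proof -
  interpret L: product_sigma_finite "\<lambda>_::nat. lborel :: (real ^ 'd) measure"
    by standard
  have "(\<integral>\<^sup>+X. ennreal (\<Prod>i<n. f (X i)) \<partial>(\<Pi>\<^sub>M i\<in>{..<n}. lborel))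
    = (\<integral>\<^sup>+X. (\<Prod>i<n. ennreal (f (X i))) \<partial>(\<Pi>\<^sub>M i\<in>{..<n}. lborel))"
    by (simp add: prod_ennreal nn)
  also have "\<dots> = (\<Prod>i<n. \<integral>\<^sup>+x. ennreal (f x) \<partial>lborel)"
    by (rule L.product_nn_integral_prod) auto
  finally show ?thesis by simp
qed

text \<open>
  The affinity of the product densities is the \<open>n\<close>-th power of that of \<open>f\<close> and \<open>g\<close>. The tolerance
  \<open>1 / (4 n)\<close> is chosen so that, by Bernoulli's inequality, the power stays above \<open>3 / 4\<close>; the
  remaining term \<open>(p + q) / 4\<close> of the pointwise bound integrates to \<open>1 / 2\<close>.
\<close>

lemma two_point_iid:
  fixes f g :: "real ^ 'd \<Rightarrow> real"
  assumes [measurable]: "f \<in> borel_measurable borel" "g \<in> borel_measurable borel"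
    and nn: "\<And>x. f x \<ge> 0" "\<And>x. g x \<ge> 0"
    and one: "(\<integral>\<^sup>+x. ennreal (f x) \<partial>lborel) = 1" "(\<integral>\<^sup>+x. ennreal (g x) \<partial>lborel) = 1"
    and aff: "(\<integral>\<^sup>+x. ennreal (sqrt (f x * g x)) \<partial>lborel) \<ge> ennreal (1 - 1 / (4 * real n))"
    and n: "n > 0"
    and [measurable]: "t \<in> borel_measurable (\<Pi>\<^sub>M i\<in>{..<n}. lborel)"
  shows "ennreal ((a - b)\<^sup>2 / 4)
    \<le> (\<integral>\<^sup>+X. ennreal ((t X - a)\<^sup>2) \<partial>iid_law n f) + (\<integral>\<^sup>+X. ennreal ((t X - b)\<^sup>2) \<partial>iid_law n g)"
proof -
  let ?L = "\<Pi>\<^sub>M i\<in>{..<n}. lborel :: (real ^ 'd) measure"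
  define p where "p = (\<lambda>X. \<Prod>i<n. f (X i))"
  define q where "q = (\<lambda>X. \<Prod>i<n. g (X i))"
  have pm[measurable]: "p \<in> borel_measurable ?L" "q \<in> borel_measurable ?L"
    by (auto simp: p_def q_def)
  have pn: "p X \<ge> 0" "q X \<ge> 0" for X by (auto simp: p_def q_def nn intro: prod_nonneg)
  have i1: "(\<integral>\<^sup>+X. ennreal (p X) \<partial>?L) = 1" "(\<integral>\<^sup>+X. ennreal (q X) \<partial>?L) = 1"
    by (simp_all add: p_def q_def nn_integral_iid_product nn one)
  let ?E = "(\<integral>\<^sup>+X. ennreal ((t X - a)\<^sup>2) \<partial>iid_law n f) + (\<integral>\<^sup>+X. ennreal ((t X - b)\<^sup>2) \<partial>iid_law n g)"
  have E: "?E = (\<integral>\<^sup>+X. ennreal (p X) * ennreal ((t X - a)\<^sup>2) \<partial>?L) + (\<integral>\<^sup>+X. ennreal (q X) * ennreal ((t X - b)\<^sup>2) \<partial>?L)"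
    unfolding p_def q_def by (simp add: nn_integral_iid_law nn one)
  have n1: "1 - 1 / (4 * real n) \<ge> 0" using n by (simp add: field_simps)
  have bern: "(3/4 :: real) \<le> (1 - 1 / (4 * real n)) ^ n"
  proof -
    have "1 + real n * (- 1 / (4 * real n)) \<le> (1 + (- 1 / (4 * real n))) ^ n"
      by (rule Bernoulli_inequality) (use n in \<open>simp add: field_simps\<close>)
    then show ?thesis using n by simp
  qed
  have sqrt_prod: "sqrt (\<Prod>i<m. h i) = (\<Prod>i<m. sqrt (h i))" for m and h :: "nat \<Rightarrow> real"
    by (induction m) (simp_all add: real_sqrt_mult)
  have "ennreal (3/4) \<le> ennreal (1 - 1 / (4 * real n)) ^ n"
    using bern n1 by (simp add: ennreal_power ennreal_leI)
  also have "\<dots> \<le> (\<integral>\<^sup>+x. ennreal (sqrt (f x * g x)) \<partial>lborel) ^ n"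
    by (rule power_mono[OF aff]) simp
  also have "\<dots> = (\<integral>\<^sup>+X. ennreal (\<Prod>i<n. sqrt (f (X i) * g (X i))) \<partial>?L)"
    by (rule nn_integral_iid_product[symmetric]) (auto simp: nn)
  also have "\<dots> = (\<integral>\<^sup>+X. ennreal (sqrt (p X * q X)) \<partial>?L)"
    by (simp add: p_def q_def sqrt_prod prod.distrib real_sqrt_mult)
  finally have A: "ennreal (3/4) \<le> (\<integral>\<^sup>+X. ennreal (sqrt (p X * q X)) \<partial>?L)" .
  let ?c = "(a - b)\<^sup>2"
  have "ennreal (?c * (3/4)) \<le> ennreal ?c * (\<integral>\<^sup>+X. ennreal (sqrt (p X * q X)) \<partial>?L)"
    using mult_left_mono[OF A, of "ennreal ?c"] by (simp add: ennreal_mult[symmetric])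
  also have "\<dots> = (\<integral>\<^sup>+X. ennreal (?c * sqrt (p X * q X)) \<partial>?L)"
    by (simp add: ennreal_mult' nn_integral_cmult)
  also have "\<dots> \<le> (\<integral>\<^sup>+X. ennreal (p X) * ennreal ((t X - a)\<^sup>2) + ennreal (q X) * ennreal ((t X - b)\<^sup>2)
       + ennreal (?c / 4) * (ennreal (p X) + ennreal (q X)) \<partial>?L)"
  proof (rule nn_integral_mono)
    fix X
    have "ennreal (?c * sqrt (p X * q X)) \<le> ennreal ((t X - a)\<^sup>2 * p X + (t X - b)\<^sup>2 * q X + ?c / 4 * (p X + q X))"
      by (rule ennreal_leI[OF two_point_pointwise[OF pn]])
    also have "\<dots> = ennreal (p X) * ennreal ((t X - a)\<^sup>2) + ennreal (q X) * ennreal ((t X - b)\<^sup>2)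
       + ennreal (?c / 4) * (ennreal (p X) + ennreal (q X))"
      using pn[of X] by (simp add: ennreal_mult[symmetric] ennreal_plus[symmetric] mult.commute del: ennreal_plus)
    finally show "ennreal (?c * sqrt (p X * q X)) \<le> \<dots>" .
  qed
  also have "\<dots> = ?E + ennreal (?c / 4) * (1 + 1)"
    unfolding E by (simp add: nn_integral_add nn_integral_cmult i1)
  also have "ennreal (?c / 4) * (1 + 1) = ennreal (?c / 2)"
  proof -
    have "(1 + 1 :: ennreal) = ennreal 2" by simp
    then show ?thesis by (simp only: ennreal_mult[symmetric] zero_le_numeral zero_le_power2 divide_nonneg_nonneg) simp
  qed
  finally have fin: "ennreal (?c * (3/4)) \<le> ?E + ennreal (?c / 2)" .
  show ?thesis
  proof (cases "?E = \<top>")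
    case False
    then obtain s where s: "?E = ennreal s" "s \<ge> 0"
      by (cases ?E) auto
    have "ennreal (?c * (3/4)) \<le> ennreal (s + ?c / 2)"
      using fin s by (simp add: ennreal_plus)
    then have "?c * (3/4) \<le> s + ?c / 2" using s by (subst (asm) ennreal_le_iff) auto
    then show ?thesis using s by (simp add: ennreal_leI)
  next
    case True
    then show ?thesis by (simp only: top_greatest)
  qed
qed


lemma bessel_ineq:
  fixes e :: "'i \<Rightarrow> 'a \<Rightarrow> real" and u :: "'a \<Rightarrow> real"
  assumes J: "finite J"
    and ei: "\<And>i j. i \<in> J \<Longrightarrow> j \<in> J \<Longrightarrow> integrable M (\<lambda>x. e i x * e j x)"
    and on: "\<And>i j. i \<in> J \<Longrightarrow> j \<in> J \<Longrightarrow> (\<integral>x. e i x * e j x \<partial>M) = (if i = j then 1 else 0)"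
    and ue: "\<And>j. j \<in> J \<Longrightarrow> integrable M (\<lambda>x. u x * e j x)"
    and u2: "integrable M (\<lambda>x. (u x)\<^sup>2)"
  shows "(\<Sum>j\<in>J. (\<integral>x. u x * e j x \<partial>M)\<^sup>2) \<le> (\<integral>x. (u x)\<^sup>2 \<partial>M)"
proof -
  define c where "c j = (\<integral>x. u x * e j x \<partial>M)" for j
  have exp: "(u x - (\<Sum>j\<in>J. c j * e j x))\<^sup>2
      = (u x)\<^sup>2 - 2 * (\<Sum>j\<in>J. c j * (u x * e j x)) + (\<Sum>i\<in>J. \<Sum>j\<in>J. c i * c j * (e i x * e j x))" for x
    by (simp add: power2_diff power2_eq_square[of "sum _ _"] sum_product sum_distrib_left sum_distrib_right mult_ac)
  have "0 \<le> (\<integral>x. (u x - (\<Sum>j\<in>J. c j * e j x))\<^sup>2 \<partial>M)" by simp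
  also have "\<dots> = (\<integral>x. (u x)\<^sup>2 \<partial>M) - 2 * (\<Sum>j\<in>J. c j * c j)
      + (\<Sum>i\<in>J. \<Sum>j\<in>J. c i * c j * (if i = j then 1 else 0))"
    unfolding exp using u2 ue ei
    by (simp add: c_def[symmetric] on cong: sum.cong)
  also have "(\<Sum>i\<in>J. \<Sum>j\<in>J. c i * c j * (if i = j then 1 else 0)) = (\<Sum>j\<in>J. c j * c j)"
    using J by (intro sum.cong refl) (simp add: if_distrib cong: if_cong)
  finally show ?thesis by (simp add: c_def power2_eq_square)
qed

text \<open>
  Bessel's inequality for \<open>g - f\<close>. An estimate \<open>g\<close> need not be integrable against \<open>e j\<close>; but if its
  loss is finite, then \<open>g - f\<close> is square-integrable and the coefficients are meaningful.
\<close>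

lemma coefficient_loss_le_L2_loss:
  fixes e :: "'i \<Rightarrow> real ^ 'd \<Rightarrow> real"
  assumes J: "finite J"
    and em[measurable]: "\<And>j. j \<in> J \<Longrightarrow> e j \<in> borel_measurable borel"
    and ei: "\<And>i j. i \<in> J \<Longrightarrow> j \<in> J \<Longrightarrow> integrable lborel (\<lambda>x. e i x * e j x)"
    and on: "\<And>i j. i \<in> J \<Longrightarrow> j \<in> J \<Longrightarrow> (\<integral>x. e i x * e j x \<partial>lborel) = (if i = j then 1 else 0)"
    and [measurable]: "g \<in> borel_measurable borel" "f \<in> borel_measurable borel"
    and fe: "\<And>j. j \<in> J \<Longrightarrow> integrable lborel (\<lambda>x. f x * e j x)"
  shows "(\<Sum>j\<in>J. ennreal (((\<integral>x. g x * e j x \<partial>lborel) - (\<integral>x. f x * e j x \<partial>lborel))\<^sup>2)) \<le> sq_L2_loss g f"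
proof (cases "sq_L2_loss g f = \<top>")
  case False
  have u2: "integrable lborel (\<lambda>x. (g x - f x)\<^sup>2)"
    by (rule integrableI_bounded) (use False in \<open>auto simp: sq_L2_loss_def less_top[symmetric]\<close>)
  have ue: "integrable lborel (\<lambda>x. (g x - f x) * e j x)" if j: "j \<in> J" for j
  proof (rule Bochner_Integration.integrable_bound)
    show "integrable lborel (\<lambda>x. (g x - f x)\<^sup>2 + e j x * e j x)" using u2 ei[OF j j] by simp
    show "(\<lambda>x. (g x - f x) * e j x) \<in> borel_measurable lborel" using em[OF j] by measurable
    have "\<bar>a * b\<bar> \<le> \<bar>a\<^sup>2 + b * b\<bar>" for a b :: real
    proof -
      have "2 * \<bar>a * b\<bar> \<le> a\<^sup>2 + b\<^sup>2"
        using sum_squares_bound[of "\<bar>a\<bar>" "\<bar>b\<bar>"] by (simp add: abs_mult)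
      moreover have "0 \<le> \<bar>a * b\<bar>" by simp
      ultimately show ?thesis unfolding power2_eq_square by linarith
    qed
    then show "AE x in lborel. norm ((g x - f x) * e j x) \<le> norm ((g x - f x)\<^sup>2 + e j x * e j x)"
      by auto
  qed
  have lin: "(\<integral>x. g x * e j x \<partial>lborel) - (\<integral>x. f x * e j x \<partial>lborel) = (\<integral>x. (g x - f x) * e j x \<partial>lborel)"
    if j: "j \<in> J" for j
  proof -
    have "integrable lborel (\<lambda>x. (g x - f x) * e j x + f x * e j x)"
      by (intro Bochner_Integration.integrable_add ue fe j)
    then have "integrable lborel (\<lambda>x. g x * e j x)" by (simp add: algebra_simps)
    then show ?thesis using fe[OF j] by (simp add: algebra_simps)
  qed
  have "(\<Sum>j\<in>J. ennreal (((\<integral>x. g x * e j x \<partial>lborel) - (\<integral>x. f x * e j x \<partial>lborel))\<^sup>2))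
    = ennreal (\<Sum>j\<in>J. (\<integral>x. (g x - f x) * e j x \<partial>lborel)\<^sup>2)"
    by (simp add: lin cong: sum.cong)
  also have "\<dots> \<le> ennreal (\<integral>x. (g x - f x)\<^sup>2 \<partial>lborel)"
    by (intro ennreal_leI bessel_ineq J ei on ue u2)
  also have "\<dots> = sq_L2_loss g f"
    unfolding sq_L2_loss_def by (rule nn_integral_eq_integral[symmetric]) (use u2 in auto)
  finally show ?thesis .
qed simp

text \<open>
  The vertices of the hypercube are grouped into the pairs joined by an edge in direction \<open>j\<close>.
\<close>

lemma sum_Pow_pairs:
  fixes r :: "'i set \<Rightarrow> ennreal"
  assumes "finite J" "j \<in> J"
  shows "(\<Sum>S\<in>Pow J. r S) = (\<Sum>S\<in>Pow (J - {j}). r S + r (insert j S))"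
proof -
  let ?K = "J - {j}"
  have J: "J = insert j ?K" using assms by auto
  have "(\<Sum>S\<in>Pow J. r S) = (\<Sum>S\<in>Pow ?K \<union> insert j ` Pow ?K. r S)"
    by (subst J, subst Pow_insert) simp
  also have "\<dots> = (\<Sum>S\<in>Pow ?K. r S) + (\<Sum>S\<in>insert j ` Pow ?K. r S)"
    by (rule sum.union_disjoint) (use assms in auto)
  also have "(\<Sum>S\<in>insert j ` Pow ?K. r S) = (\<Sum>S\<in>Pow ?K. r (insert j S))"
    by (rule sum.reindex_cong[OF _ refl refl]) (auto simp: inj_on_def)
  finally show ?thesis by (simp add: sum.distrib)
qed

text \<open>
  Assouad's argument for the squared \<open>L2\<close> loss. The supremum of the risk is at least its average
  over the hypercube, the loss dominates the sum of the squared errors of the coefficients, and for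
  each coefficient the average splits into edges, to which the two-point bound applies. The
  separation \<open>\<Delta>\<close> is asked of the \<open>j\<close>-th coefficient along edges in direction \<open>j\<close> only, which
  allows differences \<open>f (insert j S) - f S\<close> that are far from orthogonal.
\<close>

lemma hypercube_minimax_bound:
  fixes f :: "'i set \<Rightarrow> real ^ 'd \<Rightarrow> real" and e :: "'i \<Rightarrow> real ^ 'd \<Rightarrow> real"
  assumes J: "finite J" and n: "n > 0"
    and em[measurable]: "\<And>j. j \<in> J \<Longrightarrow> e j \<in> borel_measurable borel"
    and ei: "\<And>i j. i \<in> J \<Longrightarrow> j \<in> J \<Longrightarrow> integrable lborel (\<lambda>x. e i x * e j x)"
    and on: "\<And>i j. i \<in> J \<Longrightarrow> j \<in> J \<Longrightarrow> (\<integral>x. e i x * e j x \<partial>lborel) = (if i = j then 1 else 0)"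
    and F: "\<And>S. S \<subseteq> J \<Longrightarrow> f S \<in> F"
    and fm[measurable]: "\<And>S. S \<subseteq> J \<Longrightarrow> f S \<in> borel_measurable borel"
    and nn: "\<And>S x. S \<subseteq> J \<Longrightarrow> f S x \<ge> 0"
    and one: "\<And>S. S \<subseteq> J \<Longrightarrow> (\<integral>\<^sup>+x. ennreal (f S x) \<partial>lborel) = 1"
    and fe: "\<And>S j. S \<subseteq> J \<Longrightarrow> j \<in> J \<Longrightarrow> integrable lborel (\<lambda>x. f S x * e j x)"
    and sep: "\<And>S j. S \<subseteq> J \<Longrightarrow> j \<in> J \<Longrightarrow> j \<notin> S \<Longrightarrow>
      \<Delta> \<le> ((\<integral>x. f S x * e j x \<partial>lborel) - (\<integral>x. f (insert j S) x * e j x \<partial>lborel))\<^sup>2"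
    and aff: "\<And>S j. S \<subseteq> J \<Longrightarrow> j \<in> J \<Longrightarrow> j \<notin> S \<Longrightarrow>
      (\<integral>\<^sup>+x. ennreal (sqrt (f S x * f (insert j S) x)) \<partial>lborel) \<ge> ennreal (1 - 1 / (4 * real n))"
    and \<Delta>: "\<Delta> \<ge> 0"
  shows "ennreal (real (card J) * \<Delta> / 8) \<le> minimax_risk n F"
  unfolding minimax_risk_def
proof (rule INF_greatest)
  fix T :: "(nat \<Rightarrow> real ^ 'd) \<Rightarrow> real ^ 'd \<Rightarrow> real" assume "T \<in> estimators n"
  then have T[measurable]: "(\<lambda>(X, x). T X x) \<in> borel_measurable ((\<Pi>\<^sub>M i\<in>{..<n}. borel) \<Otimes>\<^sub>M borel)"
    by (simp add: estimators_def)
  let ?B = "\<Pi>\<^sub>M i\<in>{..<n}. borel :: (real ^ 'd) measure"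
  let ?L = "\<Pi>\<^sub>M i\<in>{..<n}. lborel :: (real ^ 'd) measure"
  let ?R = "SUP f\<in>F. \<integral>\<^sup>+ X. sq_L2_loss (T X) f \<partial>iid_law n f"
  define t where "t j X = (\<integral>x. T X x * e j x \<partial>lborel)" for j X
  define a where "a j S = (\<integral>x. f S x * e j x \<partial>lborel)" for j S
  define r where "r j S = (\<integral>\<^sup>+ X. ennreal ((t j X - a j S)\<^sup>2) \<partial>iid_law n (f S))" for j S
  have setsL: "sets ?L = sets ?B" by (intro sets_PiM_cong) auto
  have tB: "t j \<in> borel_measurable ?B" if j: "j \<in> J" for j
    unfolding t_def
  proof (rule lborel.borel_measurable_lebesgue_integral)
    note em[OF j, measurable]
    have "(\<lambda>(X, x). T X x * e j x) \<in> borel_measurable (?B \<Otimes>\<^sub>M borel)" by measurable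
    moreover have "sets (?B \<Otimes>\<^sub>M lborel) = sets (?B \<Otimes>\<^sub>M borel)" by (intro sets_pair_measure_cong) auto
    ultimately show "(\<lambda>(X, x). T X x * e j x) \<in> borel_measurable (?B \<Otimes>\<^sub>M lborel)"
      by (simp cong: measurable_cong_sets)
  qed
  then have tm: "t j \<in> borel_measurable ?L" if j: "j \<in> J" for j
    using that by (simp cong: measurable_cong_sets add: setsL)
  have law: "sets (iid_law n (f S)) = sets ?B" for S
    unfolding iid_law_def by (intro sets_PiM_cong) auto
  \<comment> \<open>the contribution of one edge in direction \<open>j\<close>\<close>
  have pair: "ennreal (\<Delta> / 4) \<le> r j S + r j (insert j S)" if "j \<in> J" "S \<in> Pow (J - {j})" for j S
  proof -
    have S: "S \<subseteq> J" "insert j S \<subseteq> J" "j \<notin> S" using that by auto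
    have "ennreal (\<Delta> / 4) \<le> ennreal ((a j S - a j (insert j S))\<^sup>2 / 4)"
      unfolding a_def by (intro ennreal_leI divide_right_mono sep that S) auto
    also have "\<dots> \<le> r j S + r j (insert j S)"
      unfolding r_def by (intro two_point_iid fm S nn one aff that n tm)
    finally show ?thesis .
  qed
  have "ennreal (real (card J) * 2 ^ (card J - 1) * (\<Delta> / 4)) = (\<Sum>j\<in>J. \<Sum>S\<in>Pow (J - {j}). ennreal (\<Delta> / 4))"
  proof -
    have "(\<Sum>S\<in>Pow (J - {j}). ennreal (\<Delta> / 4)) = ennreal (2 ^ (card J - 1) * (\<Delta> / 4))" if "j \<in> J" for j
      using J \<Delta> that
      by (simp add: card_Pow card_Diff_singleton ennreal_power ennreal_mult[symmetric] flip: ennreal_numeral)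
    then have "(\<Sum>j\<in>J. \<Sum>S\<in>Pow (J - {j}). ennreal (\<Delta> / 4)) = (\<Sum>j\<in>J. ennreal (2 ^ (card J - 1) * (\<Delta> / 4)))"
      by (rule sum.cong[OF refl])
    also have "\<dots> = ennreal (real (card J)) * ennreal (2 ^ (card J - 1) * (\<Delta> / 4))"
      by (simp add: ennreal_of_nat_eq_real_of_nat)
    also have "\<dots> = ennreal (real (card J) * 2 ^ (card J - 1) * (\<Delta> / 4))"
      using \<Delta> by (simp add: ennreal_mult[symmetric] mult.assoc)
    finally show ?thesis ..
  qed
  also have "\<dots> \<le> (\<Sum>j\<in>J. \<Sum>S\<in>Pow (J - {j}). r j S + r j (insert j S))"
    by (intro sum_mono pair)
  also have "\<dots> = (\<Sum>S\<in>Pow J. \<Sum>j\<in>J. r j S)"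
    by (subst sum.swap) (intro sum.cong refl sum_Pow_pairs[symmetric] J)
  also have "\<dots> \<le> (\<Sum>S\<in>Pow J. ?R)"
  proof (rule sum_mono)
    fix S assume "S \<in> Pow J"
    then have S: "S \<subseteq> J" by simp
    have "(\<Sum>j\<in>J. r j S) = (\<integral>\<^sup>+ X. (\<Sum>j\<in>J. ennreal ((t j X - a j S)\<^sup>2)) \<partial>iid_law n (f S))"
      unfolding r_def
    proof (rule nn_integral_sum[symmetric])
      fix j assume "j \<in> J"
      then have "(\<lambda>X. ennreal ((t j X - a j S)\<^sup>2)) \<in> borel_measurable ?B" using tB by measurable
      then show "(\<lambda>X. ennreal ((t j X - a j S)\<^sup>2)) \<in> borel_measurable (iid_law n (f S))"
        by (simp cong: measurable_cong_sets add: law)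
    qed
    also have "\<dots> \<le> (\<integral>\<^sup>+ X. sq_L2_loss (T X) (f S) \<partial>iid_law n (f S))"
    proof (rule nn_integral_mono)
      fix X assume "X \<in> space (iid_law n (f S))"
      then have X: "X \<in> space ?B" using sets_eq_imp_space_eq[OF law] by simp
      have "T X \<in> borel_measurable borel"
        using measurable_compose[OF measurable_Pair1'[OF X] T] by simp
      then show "(\<Sum>j\<in>J. ennreal ((t j X - a j S)\<^sup>2)) \<le> sq_L2_loss (T X) (f S)"
        unfolding t_def a_def by (intro coefficient_loss_le_L2_loss J em ei on fm S fe)
    qed
    also have "\<dots> \<le> ?R" by (rule SUP_upper[OF F[OF S]])
    finally show "(\<Sum>j\<in>J. r j S) \<le> ?R" .
  qed
  also have "\<dots> = ennreal (2 ^ card J) * ?R"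
    using J by (simp add: card_Pow ennreal_power flip: ennreal_numeral)
  finally have le: "ennreal (real (card J) * 2 ^ (card J - 1) * (\<Delta> / 4)) \<le> ennreal (2 ^ card J) * ?R" .
  show "ennreal (real (card J) * \<Delta> / 8) \<le> ?R"
  proof (cases "?R = \<top> \<or> J = {}")
    case False
    then obtain s where s: "?R = ennreal s" "s \<ge> 0" by (cases ?R) auto
    obtain m where m: "card J = Suc m" using False J by (cases "card J") auto
    have "ennreal (real (card J) * 2 ^ (card J - 1) * (\<Delta> / 4)) \<le> ennreal (2 ^ card J * s)"
      using le s by (simp add: ennreal_mult')
    then have "real (card J) * 2 ^ (card J - 1) * (\<Delta> / 4) \<le> 2 ^ card J * s"
      using s by (subst (asm) ennreal_le_iff) auto
    then have "2 ^ m * (real (card J) * (\<Delta> / 4)) \<le> 2 ^ m * (2 * s)"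
      unfolding m by (simp add: algebra_simps)
    then have "real (card J) * (\<Delta> / 4) \<le> 2 * s" by simp
    then show ?thesis using s by (simp add: ennreal_leI)
  next
    case True
    then show ?thesis
    proof
      assume R: "?R = \<top>"
      show ?thesis by (subst R) (rule top_greatest)
    qed simp
  qed
qed

section \<open>Tensor products and convolutions\<close>

lemma
  fixes F :: "'a::euclidean_space \<Rightarrow> real \<Rightarrow> real"
  assumes F: "\<And>b. b \<in> Basis \<Longrightarrow> integrable lborel (F b)"
  shows integrable_lborel_prod: "integrable lborel (\<lambda>x::'a. \<Prod>b\<in>Basis. F b (x \<bullet> b))"
    and integral_lborel_prod: "(\<integral>x. (\<Prod>b\<in>Basis. F b (x \<bullet> b)) \<partial>lborel) = (\<Prod>b\<in>Basis. \<integral>x. F b x \<partial>lborel)"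
proof -
  interpret L: product_sigma_finite "\<lambda>_::'a. lborel :: real measure" by standard
  have m: "F b \<in> borel_measurable borel" if "b \<in> Basis" for b using F[OF that] by auto
  have [measurable]: "(\<lambda>x::'a. \<Prod>b\<in>Basis. F b (x \<bullet> b)) \<in> borel_measurable borel"
    using m by (intro borel_measurable_prod measurable_compose[OF _ m]) auto
  have i: "(\<lambda>y. \<Prod>b\<in>Basis. F b ((\<Sum>c\<in>Basis. y c *\<^sub>R c) \<bullet> b)) = (\<lambda>y. \<Prod>b\<in>Basis. F b (y b))"
    by (intro ext prod.cong refl) (simp add: inner_sum_left inner_Basis if_distrib cong: if_cong)
  have [measurable]: "(\<lambda>y. \<Sum>b\<in>Basis. y b *\<^sub>R b) \<in> (\<Pi>\<^sub>M b\<in>Basis. lborel) \<rightarrow>\<^sub>M (borel :: 'a measure)"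
    by measurable
  show "integrable lborel (\<lambda>x::'a. \<Prod>b\<in>Basis. F b (x \<bullet> b))"
    unfolding lborel_eq[where 'a = 'a] by (subst integrable_distr_eq) (auto simp: i intro!: L.product_integrable_prod F)
  show "(\<integral>x. (\<Prod>b\<in>Basis. F b (x \<bullet> b)) \<partial>lborel) = (\<Prod>b\<in>Basis. \<integral>x. F b x \<partial>lborel)"
    unfolding lborel_eq[where 'a = 'a] by (subst integral_distr) (auto simp: i intro!: L.product_integral_prod F)
qed

definition tensor :: "('d::finite \<Rightarrow> real \<Rightarrow> real) \<Rightarrow> real ^ 'd \<Rightarrow> real" where
  "tensor f x = (\<Prod>k\<in>UNIV. f k (x $ k))"

lemma tensor_Basis:
  "tensor f x = (\<Prod>b\<in>Basis. f (inv (\<lambda>k. axis k (1::real)) b) (x \<bullet> b))" for x :: "real ^ ('d::finite)"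
proof -
  have inj: "inj (\<lambda>k. axis k (1::real))" by (auto simp: inj_def axis_eq_axis)
  have B: "(Basis :: (real ^ 'd) set) = range (\<lambda>k. axis k 1)" by (auto simp: Basis_vec_def)
  show ?thesis
    unfolding B prod.reindex[OF inj] tensor_def o_def
    by (simp add: inv_f_f[OF inj] cart_eq_inner_axis)
qed

lemma
  fixes f :: "'d::finite \<Rightarrow> real \<Rightarrow> real"
  assumes f: "\<And>k. integrable lborel (f k)"
  shows integrable_tensor: "integrable lborel (tensor f :: real ^ 'd \<Rightarrow> real)"
    and integral_tensor: "(\<integral>x. tensor f (x :: real ^ 'd) \<partial>lborel) = (\<Prod>k\<in>UNIV. \<integral>x. f k x \<partial>lborel)"
proof -
  have inj: "inj (\<lambda>k. axis k (1::real))" by (auto simp: inj_def axis_eq_axis)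
  have B: "(Basis :: (real ^ 'd) set) = range (\<lambda>k. axis k 1)" by (auto simp: Basis_vec_def)
  show "integrable lborel (tensor f :: real ^ 'd \<Rightarrow> real)"
    unfolding tensor_Basis[abs_def] by (intro integrable_lborel_prod f)
  have "(\<integral>x. tensor f (x :: real ^ 'd) \<partial>lborel) = (\<Prod>b\<in>(Basis :: (real ^ 'd) set). \<integral>x. f (inv (\<lambda>k. axis k (1::real)) b) x \<partial>lborel)"
    unfolding tensor_Basis by (intro integral_lborel_prod f)
  also have "\<dots> = (\<Prod>k\<in>UNIV. \<integral>x. f k x \<partial>lborel)"
    unfolding B prod.reindex[OF inj] by (simp add: inv_f_f[OF inj])
  finally show "(\<integral>x. tensor f (x :: real ^ 'd) \<partial>lborel) = (\<Prod>k\<in>UNIV. \<integral>x. f k x \<partial>lborel)" .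
qed

lemma measurable_tensor[measurable]:
  "(\<And>k. f k \<in> borel_measurable borel) \<Longrightarrow> (tensor f :: real ^ 'd \<Rightarrow> real) \<in> borel_measurable borel"
  unfolding tensor_def[abs_def]
  by (intro borel_measurable_prod measurable_compose[OF borel_measurable_nth]) auto

lemma tensor_mult: "tensor f x * tensor g x = tensor (\<lambda>k y. f k y * g k y) x"
  by (simp add: tensor_def prod.distrib)

lemma tensor_abs: "\<bar>tensor f x\<bar> = tensor (\<lambda>k y. \<bar>f k y\<bar>) x"
  by (simp add: tensor_def abs_prod)

lemma tensor_mono: "(\<And>k y. 0 \<le> f k y) \<Longrightarrow> (\<And>k y. f k y \<le> g k y) \<Longrightarrow> tensor f x \<le> tensor g x"
  unfolding tensor_def by (intro prod_mono) auto

text \<open>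
  A mixture of translates of a product kernel over a product density is a \<open>tensor\<close> of such
  convolutions.
\<close>

definition conv :: "(real \<Rightarrow> real) \<Rightarrow> (real \<Rightarrow> real) \<Rightarrow> real \<Rightarrow> real" where
  "conv K g x = (\<integral>\<mu>. K (x - \<mu>) * g \<mu> \<partial>lborel)"

lemma
  fixes K g :: "real \<Rightarrow> real"
  assumes K: "integrable lborel K" and g: "integrable lborel g"
  shows integrable_conv: "integrable lborel (conv K g)"
    and integral_conv: "(\<integral>x. conv K g x \<partial>lborel) = (\<integral>x. K x \<partial>lborel) * (\<integral>x. g x \<partial>lborel)"
proof -
  have [measurable]: "K \<in> borel_measurable borel" "g \<in> borel_measurable borel" using K g by auto
  have sh: "integrable lborel (\<lambda>x. K (x - \<mu>))" "(\<integral>x. K (x - \<mu>) \<partial>lborel) = (\<integral>x. K x \<partial>lborel)" for \<mu>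
    using lborel_integrable_real_affine[OF K, of 1 "- \<mu>"] lborel_integral_real_affine[of 1 K "- \<mu>"] by simp_all
  have shn: "(\<integral>x. \<bar>K (x - \<mu>)\<bar> \<partial>lborel) = (\<integral>x. \<bar>K x\<bar> \<partial>lborel)" for \<mu>
    using lborel_integral_real_affine[of 1 "\<lambda>x. \<bar>K x\<bar>" "- \<mu>"] by simp
  have int: "integrable (lborel \<Otimes>\<^sub>M lborel) (\<lambda>(\<mu>, x). K (x - \<mu>) * g \<mu>)"
  proof (rule lborel_pair.Fubini_integrable)
    show "integrable lborel (\<lambda>\<mu>. \<integral>x. norm (case (\<mu>, x) of (\<mu>, x) \<Rightarrow> K (x - \<mu>) * g \<mu>) \<partial>lborel)"
      using g by (simp add: abs_mult shn)
  qed (use sh(1) in auto)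
  from lborel_pair.integrable_snd[OF int] show "integrable lborel (conv K g)"
    by (simp add: conv_def[abs_def])
  have "(\<integral>x. conv K g x \<partial>lborel) = (\<integral>\<mu>. (\<integral>x. K (x - \<mu>) * g \<mu> \<partial>lborel) \<partial>lborel)"
    unfolding conv_def by (rule lborel_pair.Fubini_integral[OF int])
  then show "(\<integral>x. conv K g x \<partial>lborel) = (\<integral>x. K x \<partial>lborel) * (\<integral>x. g x \<partial>lborel)"
    by (simp add: sh(2))
qed

lemma integrable_conv_integrand:
  fixes K g :: "real \<Rightarrow> real"
  assumes "K \<in> borel_measurable borel" "\<And>x. \<bar>K x\<bar> \<le> B" "integrable lborel g"
  shows "integrable lborel (\<lambda>\<mu>. K (x - \<mu>) * g \<mu>)"
proof (rule Bochner_Integration.integrable_bound)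
  show "integrable lborel (\<lambda>\<mu>. B * g \<mu>)" using assms(3) by simp
  have [measurable]: "K \<in> borel_measurable borel" "g \<in> borel_measurable borel" using assms by auto
  show "(\<lambda>\<mu>. K (x - \<mu>) * g \<mu>) \<in> borel_measurable lborel" by measurable
  have "\<bar>K (x - \<mu>)\<bar> * \<bar>g \<mu>\<bar> \<le> \<bar>B\<bar> * \<bar>g \<mu>\<bar>" for \<mu>
    using assms(2)[of "x - \<mu>"] by (intro mult_right_mono) auto
  then show "AE \<mu> in lborel. norm (K (x - \<mu>) * g \<mu>) \<le> norm (B * g \<mu>)" by (auto simp: abs_mult)
qed

text \<open>
  The squared Hellinger distance is controlled by the chi-square distance: with
  \<open>a = sqrt f\<close> and \<open>b = sqrt g\<close> one has \<open>(f - g)^2 = (a - b)^2 (a + b)^2\<close>, and \<open>(a + b)^2\<close> is at least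
  \<open>2 h\<close>.
\<close>

lemma sqrt_mult_ge:
  fixes f g h :: real
  assumes "h > 0" "f \<ge> h / 2" "g \<ge> h / 2"
  shows "(f + g) / 2 - (f - g)\<^sup>2 / (4 * h) \<le> sqrt (f * g)"
proof -
  define a b where "a = sqrt f" and "b = sqrt g"
  have f: "f = a\<^sup>2" "g = b\<^sup>2" "a \<ge> 0" "b \<ge> 0" using assms by (simp_all add: a_def b_def)
  have "(h / 2)\<^sup>2 \<le> f * g"
    using assms mult_mono[of "h/2" f "h/2" g] by (simp add: power2_eq_square)
  then have "h / 2 \<le> a * b"
    unfolding a_def b_def real_sqrt_mult[symmetric] by (rule real_le_rsqrt)
  then have "2 * h \<le> (a + b)\<^sup>2"
    using assms f by (simp add: power2_sum)
  then have "2 * h * (a - b)\<^sup>2 \<le> (a + b)\<^sup>2 * (a - b)\<^sup>2"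
    by (intro mult_right_mono) auto
  also have "\<dots> = (f - g)\<^sup>2" unfolding f by (simp add: power2_eq_square algebra_simps)
  finally have "(a - b)\<^sup>2 / 2 \<le> (f - g)\<^sup>2 / (4 * h)" using assms by (simp add: field_simps)
  moreover have "sqrt (f * g) = a * b" by (simp add: a_def b_def real_sqrt_mult)
  moreover have "(a - b)\<^sup>2 / 2 = (f + g) / 2 - a * b" unfolding f by (simp add: power2_eq_square field_simps)
  ultimately show ?thesis by linarith
qed

lemma abs_conv_le:
  fixes K g h :: "real \<Rightarrow> real"
  assumes Kh: "integrable lborel (\<lambda>\<mu>. K (x - \<mu>) * h \<mu>)" and Kg: "integrable lborel (\<lambda>\<mu>. K (x - \<mu>) * g \<mu>)"
    and K: "\<And>x. K x \<ge> 0" and h: "\<And>x. \<bar>h x\<bar> \<le> M * g x"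
  shows "\<bar>conv K h x\<bar> \<le> M * conv K g x"
proof -
  have "\<bar>conv K h x\<bar> \<le> (\<integral>\<mu>. \<bar>K (x - \<mu>) * h \<mu>\<bar> \<partial>lborel)"
    unfolding conv_def using integral_norm_bound[of lborel "\<lambda>\<mu>. K (x - \<mu>) * h \<mu>"] by simp
  also have "\<dots> \<le> (\<integral>\<mu>. M * (K (x - \<mu>) * g \<mu>) \<partial>lborel)"
  proof (rule integral_mono)
    show "\<bar>K (x - \<mu>) * h \<mu>\<bar> \<le> M * (K (x - \<mu>) * g \<mu>)" for \<mu>
      using mult_left_mono[OF h[of \<mu>] K[of "x - \<mu>"]] K[of "x - \<mu>"] by (simp add: abs_mult mult_ac)
  qed (use Kh Kg in auto)
  finally show ?thesis by (simp add: conv_def)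
qed

lemma
  fixes P :: "'i \<Rightarrow> 'a \<Rightarrow> real"
  assumes Q: "integrable M Q" and P: "\<And>i. i \<in> S \<Longrightarrow> integrable M (P i)"
  shows integrable_add_combination: "integrable M (\<lambda>x. Q x + (\<Sum>i\<in>S. c i * P i x))"
    and integral_add_combination:
      "(\<integral>x. Q x + (\<Sum>i\<in>S. c i * P i x) \<partial>M) = (\<integral>x. Q x \<partial>M) + (\<Sum>i\<in>S. c i * (\<integral>x. P i x \<partial>M))"
proof -
  have s: "integrable M (\<lambda>x. \<Sum>i\<in>S. c i * P i x)"
    by (intro Bochner_Integration.integrable_sum integrable_mult_right P)
  show "integrable M (\<lambda>x. Q x + (\<Sum>i\<in>S. c i * P i x))" by (intro Bochner_Integration.integrable_add Q s)
  show "(\<integral>x. Q x + (\<Sum>i\<in>S. c i * P i x) \<partial>M) = (\<integral>x. Q x \<partial>M) + (\<Sum>i\<in>S. c i * (\<integral>x. P i x \<partial>M))"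
    by (subst Bochner_Integration.integral_add[OF Q s], subst Bochner_Integration.integral_sum)
       (auto intro: integrable_mult_right P)
qed

text \<open>
  The reduction to the real line. The densities are \<open>F0 + (\<Sum>i\<in>S. \<epsilon> i * V i)\<close>, where \<open>F0\<close> and \<open>V i\<close>
  are mixtures over the product density \<open>G0\<close> and the product direction \<open>H i\<close>. Here \<open>\<sigma> j\<close> is the
  common order of the signal (at least \<open>a \<sigma> j\<close>) and the noise (at most \<open>sqrt b \<sigma> j\<close>) at
  frequency \<open>j\<close>. The factor \<open>\<sigma>\<close> cancels in the bound, but the mixing measures stay nonnegative only if
  it is not too small; \<open>small\<close> expresses this in terms of a lower bound \<open>s\<close> of \<open>\<sigma>\<close>.
\<close>

lemma tensor_minimax_bound:
  fixes \<phi> :: "real ^ 'd \<Rightarrow> real" and K g :: "real \<Rightarrow> real" and h e :: "nat \<Rightarrow> real \<Rightarrow> real"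
    and \<sigma> :: "nat \<Rightarrow> real"
  assumes \<phi>: "\<And>x. rescale \<phi> \<nu> x = tensor (\<lambda>_. K) x"
    and I: "finite I" and n: "n > 0"
    and K: "integrable lborel K" "(\<integral>x. K x \<partial>lborel) = 1" "\<And>x. 0 \<le> K x" "\<And>x. K x \<le> B"
    and g: "integrable lborel g" "(\<integral>x. g x \<partial>lborel) = 1" "\<And>x. 0 \<le> g x"
    and h: "\<And>j. j \<in> I \<Longrightarrow> h j \<in> borel_measurable borel" "\<And>j x. j \<in> I \<Longrightarrow> \<bar>h j x\<bar> \<le> M * g x"
      "\<And>j. j \<in> I \<Longrightarrow> (\<integral>x. h j x \<partial>lborel) = 0"
    and e: "\<And>j. j \<in> I \<Longrightarrow> e j \<in> borel_measurable borel" "\<And>j x. j \<in> I \<Longrightarrow> \<bar>e j x\<bar> \<le> E"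
      "\<And>i j. i \<in> I \<Longrightarrow> j \<in> I \<Longrightarrow> integrable lborel (\<lambda>x. e i x * e j x)"
      "\<And>i j. i \<in> I \<Longrightarrow> j \<in> I \<Longrightarrow> (\<integral>x. e i x * e j x \<partial>lborel) = (if i = j then 1 else 0)"
    and f0: "\<And>x. conv K g x > 0"
    and chi: "\<And>j. j \<in> I \<Longrightarrow> integrable lborel (\<lambda>x. (conv K (h j) x)\<^sup>2 / conv K g x)"
      "\<And>j. j \<in> I \<Longrightarrow> (\<integral>x. (conv K (h j) x)\<^sup>2 / conv K g x \<partial>lborel) \<le> b * (\<sigma> j)\<^sup>2"
    and cor: "\<And>j. j \<in> I \<Longrightarrow> (\<integral>x. conv K (h j) x * e j x \<partial>lborel) \<ge> a * \<sigma> j"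
    and pos: "a > 0" "b > 0" "s > 0" "M \<ge> 0" "\<And>j. j \<in> I \<Longrightarrow> s \<le> \<sigma> j"
    and small: "(real (card I) * M) ^ CARD('d) \<le> sqrt (real n) * (sqrt b * s) ^ CARD('d) / 2"
  shows "ennreal (real (card I) ^ CARD('d) * (a\<^sup>2 / b) ^ CARD('d) / (8 * real n))
    \<le> minimax_risk n (mixture_class \<phi> \<nu>)"
proof -
  let ?d = "CARD('d)"
  define J :: "('d \<Rightarrow> nat) set" where "J = (UNIV \<rightarrow>\<^sub>E I)"
  define N where "N i = (\<Prod>k\<in>UNIV. sqrt b * \<sigma> (i k))" for i :: "'d \<Rightarrow> nat"
  \<comment> \<open>the amplitude at which the chi-square distance along an edge is at most \<open>1 / n\<close>\<close>
  define \<epsilon> where "\<epsilon> i = 1 / (sqrt (real n) * N i)" for i :: "'d \<Rightarrow> nat"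
  define H where "H i = tensor (\<lambda>k. h (i k))" for i :: "'d \<Rightarrow> nat"
  define V where "V i = tensor (\<lambda>k. conv K (h (i k)))" for i :: "'d \<Rightarrow> nat"
  define W where "W i = tensor (\<lambda>k. e (i k))" for i :: "'d \<Rightarrow> nat"
  define G0 :: "real ^ 'd \<Rightarrow> real" where "G0 = tensor (\<lambda>_. g)"
  define F0 :: "real ^ 'd \<Rightarrow> real" where "F0 = tensor (\<lambda>_. conv K g)"
  define \<gamma> where "\<gamma> S x = G0 x + (\<Sum>i\<in>S. \<epsilon> i * H i x)" for S x
  define f where "f S x = F0 x + (\<Sum>i\<in>S. \<epsilon> i * V i x)" for S x
  have J: "finite J" "card J = card I ^ ?d" unfolding J_def using I by (auto simp: finite_PiE card_PiE)
  have JI: "i k \<in> I" if "i \<in> J" for i k using that by (auto simp: J_def)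
  have finS: "finite S" if "S \<subseteq> J" for S using J(1) that by (rule finite_subset[rotated])
  have \<sigma>: "\<sigma> j > 0" if "j \<in> I" for j using pos(3) pos(5)[OF that] by linarith
  have N: "N i \<ge> (sqrt b * s) ^ ?d" "N i > 0" if "i \<in> J" for i
  proof -
    have "(\<Prod>k\<in>(UNIV::'d set). sqrt b * s) \<le> N i"
      unfolding N_def by (intro prod_mono) (use pos JI[OF that] in auto)
    then show "N i \<ge> (sqrt b * s) ^ ?d" by simp
    show "N i > 0" unfolding N_def using pos(2) \<sigma> JI[OF that] by (intro prod_pos) auto
  qed
  have \<epsilon>: "\<epsilon> i > 0" if "i \<in> J" for i using N(2)[OF that] n by (simp add: \<epsilon>_def)
  \<comment> \<open>all perturbations together take away at most half of the mixing density\<close>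
  have sum_eps: "(\<Sum>i\<in>S. \<epsilon> i * M ^ ?d) \<le> 1 / 2" if S: "S \<subseteq> J" for S
  proof -
    have p: "sqrt (real n) * (sqrt b * s) ^ ?d > 0" using pos n by simp
    have "(\<Sum>i\<in>S. \<epsilon> i * M ^ ?d) \<le> (\<Sum>i\<in>J. \<epsilon> i * M ^ ?d)"
      by (intro sum_mono2 J S) (use \<epsilon> pos in \<open>simp add: less_imp_le\<close>)
    also have "\<dots> \<le> (\<Sum>i\<in>J. 1 / (sqrt (real n) * (sqrt b * s) ^ ?d) * M ^ ?d)"
      unfolding \<epsilon>_def using N p pos n
      by (intro sum_mono mult_right_mono divide_left_mono mult_left_mono mult_pos_pos) auto
    also have "\<dots> = (real (card I) * M) ^ ?d / (sqrt (real n) * (sqrt b * s) ^ ?d)"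
      by (simp add: J power_mult_distrib)
    also have "\<dots> \<le> 1 / 2"
      using small p by (simp add: pos_divide_le_eq)
    finally show ?thesis .
  qed
  have hi: "integrable lborel (h j)" if "j \<in> I" for j
  proof (rule Bochner_Integration.integrable_bound)
    show "integrable lborel (\<lambda>x. M * g x)" using g(1) by simp
    show "h j \<in> borel_measurable lborel" using h(1)[OF that] by simp
    show "AE x in lborel. norm (h j x) \<le> norm (M * g x)"
      using h(2)[OF that] order_trans[OF _ abs_ge_self] by (intro AE_I2) (simp only: real_norm_def, blast)
  qed
  have Km: "K \<in> borel_measurable borel" "\<bar>K x\<bar> \<le> B" for x
    using borel_measurable_integrable[OF K(1)] K(3,4)[of x] by simp_all
  note Kg = integrable_conv_integrand[OF Km g(1)]
  note Kh = integrable_conv_integrand[OF Km hi]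
  have V_le: "\<bar>V i x\<bar> \<le> M ^ ?d * F0 x" if "i \<in> J" for i x
  proof -
    have "\<bar>V i x\<bar> \<le> tensor (\<lambda>_ y. M * conv K g y) x"
      unfolding V_def tensor_abs using JI[OF that]
      by (intro tensor_mono abs_conv_le Kg Kh K h) auto
    then show ?thesis by (simp add: F0_def tensor_def prod.distrib)
  qed
  have H_le: "\<bar>H i x\<bar> \<le> M ^ ?d * G0 x" if "i \<in> J" for i x
  proof -
    have "\<bar>H i x\<bar> \<le> tensor (\<lambda>_ y. M * g y) x"
      unfolding H_def tensor_abs using JI[OF that] by (intro tensor_mono h) auto
    then show ?thesis by (simp add: G0_def tensor_def prod.distrib)
  qed
  have pert: "\<bar>\<Sum>i\<in>S. \<epsilon> i * P i\<bar> \<le> Q / 2"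
    if S: "S \<subseteq> J" and P: "\<And>i. i \<in> J \<Longrightarrow> \<bar>P i\<bar> \<le> M ^ ?d * Q" and Q: "Q \<ge> 0" for S P Q
  proof -
    have "\<bar>\<Sum>i\<in>S. \<epsilon> i * P i\<bar> \<le> (\<Sum>i\<in>S. \<bar>\<epsilon> i * P i\<bar>)" by (rule sum_abs)
    also have "\<dots> \<le> (\<Sum>i\<in>S. \<epsilon> i * M ^ ?d * Q)"
    proof (rule sum_mono)
      fix i assume "i \<in> S"
      then have i: "i \<in> J" using S by auto
      show "\<bar>\<epsilon> i * P i\<bar> \<le> \<epsilon> i * M ^ ?d * Q"
        using mult_left_mono[OF P[OF i], of "\<epsilon> i"] \<epsilon>[OF i] by (simp add: abs_mult)
    qed
    also have "\<dots> = (\<Sum>i\<in>S. \<epsilon> i * M ^ ?d) * Q" by (simp add: sum_distrib_right)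
    also have "\<dots> \<le> 1 / 2 * Q" by (intro mult_right_mono sum_eps S Q)
    finally show ?thesis by simp
  qed
  have F0pos: "F0 x > 0" for x unfolding F0_def tensor_def by (intro prod_pos) (auto simp: f0)
  have G0nn: "G0 x \<ge> 0" for x unfolding G0_def tensor_def by (intro prod_nonneg) (auto simp: g)
  have f_ge: "f S x \<ge> F0 x / 2" if "S \<subseteq> J" for S x
    using pert[OF that, of "\<lambda>i. V i x" "F0 x"] V_le[of _ x] F0pos[of x] unfolding f_def by fastforce
  have \<gamma>nn: "\<gamma> S x \<ge> 0" if "S \<subseteq> J" for S x
    using pert[OF that, of "\<lambda>i. H i x" "G0 x"] H_le[of _ x] G0nn[of x] unfolding \<gamma>_def by fastforce
  have intF0: "integrable lborel F0" "(\<integral>x. F0 x \<partial>lborel) = 1"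
    unfolding F0_def using integrable_conv[OF K(1) g(1)] integral_conv[OF K(1) g(1)]
    by (simp_all add: integrable_tensor integral_tensor K g)
  have intG0: "integrable lborel G0" "(\<integral>x. G0 x \<partial>lborel) = 1"
    unfolding G0_def by (simp_all add: integrable_tensor integral_tensor g)
  have intV: "integrable lborel (V i)" "(\<integral>x. V i x \<partial>lborel) = 0" if "i \<in> J" for i
    unfolding V_def using integrable_conv[OF K(1) hi] integral_conv[OF K(1) hi] h(3) JI[OF that]
    by (simp_all add: integrable_tensor integral_tensor)
  have intH: "integrable lborel (H i)" "(\<integral>x. H i x \<partial>lborel) = 0" if "i \<in> J" for i
    unfolding H_def using hi h(3) JI[OF that]
    by (simp_all add: integrable_tensor integral_tensor)
  have intf: "integrable lborel (f S)" "(\<integral>x. f S x \<partial>lborel) = 1" if S: "S \<subseteq> J" for S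
  proof -
    have i: "integrable lborel (V i)" "(\<integral>x. V i x \<partial>lborel) = 0" if "i \<in> S" for i using intV S that by auto
    show "integrable lborel (f S)"
      unfolding f_def[abs_def] by (intro integrable_add_combination intF0 i)
    show "(\<integral>x. f S x \<partial>lborel) = 1"
      unfolding f_def integral_add_combination[OF intF0(1) i(1)] by (simp add: intF0 i)
  qed
  have int\<gamma>: "integrable lborel (\<gamma> S)" "(\<integral>x. \<gamma> S x \<partial>lborel) = 1" if S: "S \<subseteq> J" for S
  proof -
    have i: "integrable lborel (H i)" "(\<integral>x. H i x \<partial>lborel) = 0" if "i \<in> S" for i using intH S that by auto
    show "integrable lborel (\<gamma> S)"
      unfolding \<gamma>_def[abs_def] by (intro integrable_add_combination intG0 i)
    show "(\<integral>x. \<gamma> S x \<partial>lborel) = 1"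
      unfolding \<gamma>_def integral_add_combination[OF intG0(1) i(1)] by (simp add: intG0 i)
  qed
  have mix: "f S \<in> mixture_class \<phi> \<nu>" if S: "S \<subseteq> J" for S
  proof -
    let ?G = "density lborel (\<lambda>x. ennreal (\<gamma> S x))"
    have \<gamma>m[measurable]: "\<gamma> S \<in> borel_measurable borel" using int\<gamma>(1)[OF S] by auto
    have "prob_space ?G"
    proof (rule prob_spaceI)
      have "emeasure ?G (space ?G) = (\<integral>\<^sup>+x. ennreal (\<gamma> S x) \<partial>lborel)" by (simp add: emeasure_density)
      also have "\<dots> = 1" using nn_integral_eq_integral[OF int\<gamma>(1)[OF S]] \<gamma>nn[OF S] int\<gamma>(2)[OF S] by simp
      finally show "emeasure ?G (space ?G) = 1" .
    qed
    moreover have "location_mixture \<phi> \<nu> ?G x = f S x" for x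
    proof -
      let ?T = "\<lambda>\<mu>. tensor (\<lambda>_. K) (x - \<mu>)"
      have tg: "G0 \<mu> * ?T \<mu> = tensor (\<lambda>k y. K (x $ k - y) * g y) \<mu>" for \<mu>
        unfolding G0_def by (simp add: tensor_def prod.distrib)
      have th: "H i \<mu> * ?T \<mu> = tensor (\<lambda>k y. K (x $ k - y) * h (i k) y) \<mu>" for \<mu> i
        unfolding H_def by (simp add: tensor_def prod.distrib)
      have ig: "integrable lborel (\<lambda>\<mu>. G0 \<mu> * ?T \<mu>)" "(\<integral>\<mu>. G0 \<mu> * ?T \<mu> \<partial>lborel) = F0 x"
        unfolding tg F0_def using Kg by (simp_all add: integrable_tensor integral_tensor) (simp add: tensor_def conv_def)
      have ih: "integrable lborel (\<lambda>\<mu>. H i \<mu> * ?T \<mu>)" "(\<integral>\<mu>. H i \<mu> * ?T \<mu> \<partial>lborel) = V i x" if "i \<in> S" for i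
      proof -
        have k: "i k \<in> I" for k using JI S that by auto
        show "integrable lborel (\<lambda>\<mu>. H i \<mu> * ?T \<mu>)" "(\<integral>\<mu>. H i \<mu> * ?T \<mu> \<partial>lborel) = V i x"
          unfolding th V_def using Kh[OF k] by (simp_all add: integrable_tensor integral_tensor) (simp add: tensor_def conv_def)
      qed
      have Tm: "?T \<in> borel_measurable borel"
        by (rule measurable_compose[OF _ measurable_tensor]) (use Km(1) in auto)
      have "location_mixture \<phi> \<nu> ?G x = (\<integral>\<mu>. \<gamma> S \<mu> * ?T \<mu> \<partial>lborel)"
        unfolding location_mixture_def \<phi> using Tm \<gamma>nn[OF S] by (subst integral_density) auto
      also have "\<dots> = (\<integral>\<mu>. G0 \<mu> * ?T \<mu> + (\<Sum>i\<in>S. \<epsilon> i * (H i \<mu> * ?T \<mu>)) \<partial>lborel)"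
        unfolding \<gamma>_def by (simp add: distrib_right sum_distrib_right mult.assoc)
      also have "\<dots> = f S x"
        unfolding integral_add_combination[OF ig(1) ih(1)] f_def by (simp add: ig ih)
      finally show ?thesis .
    qed
    ultimately show ?thesis unfolding mixture_class_def by (auto intro!: exI[of _ ?G])
  qed
  have ins: "f (insert i S) x = f S x + \<epsilon> i * V i x" if "S \<subseteq> J" "i \<notin> S" for S i x
    using finS[OF that(1)] that(2) by (simp add: f_def)
  have Wm: "W i \<in> borel_measurable borel" if "i \<in> J" for i
    unfolding W_def using e(1) JI[OF that] by auto
  have WW: "W i x * W j x = tensor (\<lambda>k y. e (i k) y * e (j k) y) x" for i j x
    unfolding W_def by (rule tensor_mult)
  have VW: "V i x * W i x = tensor (\<lambda>k y. conv K (h (i k)) y * e (i k) y) x" for i x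
    unfolding W_def V_def by (rule tensor_mult)
  have W_le: "\<bar>W i x\<bar> \<le> E ^ ?d" if "i \<in> J" for i x
  proof -
    have "\<bar>W i x\<bar> \<le> tensor (\<lambda>_ _. E) x"
      unfolding W_def tensor_abs using JI[OF that] by (intro tensor_mono e) auto
    then show ?thesis by (simp add: tensor_def)
  qed
  have bound_int: "integrable M' (\<lambda>x. p x * q x)"
    if "integrable M' p" "q \<in> borel_measurable M'" "\<And>x. \<bar>q x\<bar> \<le> C"
    for M' :: "'z measure" and p q :: "'z \<Rightarrow> real" and C
  proof (rule Bochner_Integration.integrable_bound)
    show "integrable M' (\<lambda>x. C * p x)" using that by simp
    have "\<bar>p x\<bar> * \<bar>q x\<bar> \<le> \<bar>C\<bar> * \<bar>p x\<bar>" for x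
      using mult_right_mono[OF order_trans[OF that(3)[of x] abs_ge_self], of "\<bar>p x\<bar>"] by (simp add: mult.commute)
    then show "AE x in M'. norm (p x * q x) \<le> norm (C * p x)" by (auto simp: abs_mult)
  qed (use that in auto)
  let ?\<Delta> = "(a\<^sup>2 / b) ^ ?d / real n"
  have "ennreal (real (card J) * ?\<Delta> / 8) \<le> minimax_risk n (mixture_class \<phi> \<nu>)"
  proof (rule hypercube_minimax_bound[where f = f and e = W])
    show "finite J" "n > 0" by fact+
    show "W j \<in> borel_measurable borel" if "j \<in> J" for j by (rule Wm[OF that])
    show "integrable lborel (\<lambda>x. W i x * W j x)" if "i \<in> J" "j \<in> J" for i j
      unfolding WW using e(3) JI that by (intro integrable_tensor) auto
    show "(\<integral>x. W i x * W j x \<partial>lborel) = (if i = j then 1 else 0)" if "i \<in> J" "j \<in> J" for i j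
    proof -
      have "(\<integral>x. W i x * W j x \<partial>lborel) = (\<Prod>k\<in>UNIV. if i k = j k then 1 else 0)"
        unfolding WW using e(3,4) JI that by (subst integral_tensor) auto
      also have "\<dots> = (if i = j then 1 else 0)" by (auto simp: fun_eq_iff prod_zero_iff)
      finally show ?thesis .
    qed
    show "f S \<in> mixture_class \<phi> \<nu>" if "S \<subseteq> J" for S by (rule mix[OF that])
    show "f S \<in> borel_measurable borel" if "S \<subseteq> J" for S using intf(1)[OF that] by auto
    show fnn: "f S x \<ge> 0" if "S \<subseteq> J" for S x using f_ge[OF that, of x] F0pos[of x] by linarith
    show "(\<integral>\<^sup>+x. ennreal (f S x) \<partial>lborel) = 1" if "S \<subseteq> J" for S
      using nn_integral_eq_integral[OF intf(1)[OF that]] fnn[OF that] intf(2)[OF that] by simp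
    show fW: "integrable lborel (\<lambda>x. f S x * W j x)" if "S \<subseteq> J" "j \<in> J" for S j
      using bound_int[OF intf(1)[OF that(1)] _ W_le[OF that(2)]] Wm[OF that(2)] by simp
    show "?\<Delta> \<le> ((\<integral>x. f S x * W j x \<partial>lborel) - (\<integral>x. f (insert j S) x * W j x \<partial>lborel))\<^sup>2"
      if S: "S \<subseteq> J" "j \<in> J" "j \<notin> S" for S j
    proof -
      have jk: "j k \<in> I" for k by (rule JI[OF S(2)])
      have iv: "integrable lborel (\<lambda>y. conv K (h (j k)) y * e (j k) y)" for k
        using bound_int[OF integrable_conv[OF K(1) hi[OF jk]] _ e(2)[OF jk]] e(1)[OF jk] by simp
      have VWi: "integrable lborel (\<lambda>x. V j x * W j x)"
        unfolding VW by (intro integrable_tensor iv)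
      have "(\<integral>x. f (insert j S) x * W j x \<partial>lborel) = (\<integral>x. f S x * W j x + \<epsilon> j * (V j x * W j x) \<partial>lborel)"
        unfolding ins[OF S(1,3)] by (simp add: distrib_right mult.assoc)
      also have "\<dots> = (\<integral>x. f S x * W j x \<partial>lborel) + \<epsilon> j * (\<integral>x. V j x * W j x \<partial>lborel)"
        using fW[OF S(1,2)] VWi by simp
      finally have diff: "((\<integral>x. f S x * W j x \<partial>lborel) - (\<integral>x. f (insert j S) x * W j x \<partial>lborel))\<^sup>2
          = (\<epsilon> j * (\<integral>x. V j x * W j x \<partial>lborel))\<^sup>2" by (simp add: power2_eq_square)
      have "(\<Prod>k\<in>UNIV. a * \<sigma> (j k)) \<le> (\<integral>x. V j x * W j x \<partial>lborel)"
        unfolding VW integral_tensor[OF iv]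
        by (intro prod_mono) (use pos \<sigma>[OF jk] cor[OF jk] in \<open>auto simp: less_imp_le\<close>)
      then have "(\<epsilon> j * (\<Prod>k\<in>UNIV. a * \<sigma> (j k)))\<^sup>2 \<le> (\<epsilon> j * (\<integral>x. V j x * W j x \<partial>lborel))\<^sup>2"
        using \<epsilon>[OF S(2)] pos(1) \<sigma>[OF jk]
        by (intro power_mono mult_left_mono mult_nonneg_nonneg prod_nonneg) (auto simp: less_imp_le)
      moreover have "\<epsilon> j * (\<Prod>k\<in>UNIV. a * \<sigma> (j k)) = (a / sqrt b) ^ ?d / sqrt (real n)"
        using \<sigma>[OF jk] by (simp add: \<epsilon>_def N_def prod.distrib power_divide less_imp_neq[symmetric])
      moreover have "((a / sqrt b) ^ ?d / sqrt (real n))\<^sup>2 = ?\<Delta>"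
        using pos(2) by (simp add: power_divide power_mult_distrib power_mult[symmetric] mult.commute[of ?d 2])
           (simp add: power_mult)
      ultimately show ?thesis unfolding diff by simp
    qed
    show "ennreal (1 - 1 / (4 * real n)) \<le> (\<integral>\<^sup>+x. ennreal (sqrt (f S x * f (insert j S) x)) \<partial>lborel)"
      if S: "S \<subseteq> J" "j \<in> J" "j \<notin> S" for S j
    proof -
      have S': "insert j S \<subseteq> J" using S by auto
      have jk: "j k \<in> I" for k by (rule JI[OF S(2)])
      have vf: "(V j x)\<^sup>2 / F0 x = tensor (\<lambda>k y. (conv K (h (j k)) y)\<^sup>2 / conv K g y) x" for x
        unfolding V_def F0_def tensor_def by (simp add: prod_power_distrib prod_dividef)
      have ivf: "integrable lborel (\<lambda>x. (V j x)\<^sup>2 / F0 x)"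
        unfolding vf by (intro integrable_tensor chi jk)
      have "(\<integral>x. (V j x)\<^sup>2 / F0 x \<partial>lborel) \<le> (\<Prod>k\<in>UNIV. b * (\<sigma> (j k))\<^sup>2)"
        unfolding vf integral_tensor[OF chi(1)[OF jk]]
        by (intro prod_mono conjI chi jk integral_nonneg_AE) (auto simp: less_imp_le f0)
      also have "\<dots> = (N j)\<^sup>2"
        using pos(2) by (simp add: N_def prod_power_distrib power_mult_distrib)
      finally have chi2: "(\<epsilon> j)\<^sup>2 * (\<integral>x. (V j x)\<^sup>2 / F0 x \<partial>lborel) \<le> 1 / real n"
        using N(2)[OF S(2)] n
        by (simp add: \<epsilon>_def power_divide power_mult_distrib field_simps)
      let ?p = "\<lambda>x. (f S x + f (insert j S) x) / 2 - (\<epsilon> j)\<^sup>2 / 4 * ((V j x)\<^sup>2 / F0 x)"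
      let ?q = "\<lambda>x. sqrt (f S x * f (insert j S) x)"
      have fi: "integrable lborel (f S)" "integrable lborel (f (insert j S))"
        using intf(1)[OF S(1)] intf(1)[OF S'] by auto
      have pq: "?p x \<le> ?q x" for x
      proof -
        have "(f S x + f (insert j S) x) / 2 - (f S x - f (insert j S) x)\<^sup>2 / (4 * F0 x) \<le> ?q x"
          by (rule sqrt_mult_ge[OF F0pos f_ge[OF S(1)] f_ge[OF S']])
        also have "(f S x - f (insert j S) x)\<^sup>2 = (\<epsilon> j)\<^sup>2 * (V j x)\<^sup>2"
          unfolding ins[OF S(1,3)] by (simp add: power_mult_distrib)
        finally show ?thesis by (simp add: mult.commute)
      qed
      have qi: "integrable lborel ?q"
      proof (rule Bochner_Integration.integrable_bound)
        show "integrable lborel (\<lambda>x. f S x + f (insert j S) x)" using fi by simp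
        show "?q \<in> borel_measurable lborel" using fi by auto
        have "?q x \<le> f S x + f (insert j S) x" for x
        proof (rule order_trans[OF arith_geo_mean_sqrt[OF fnn[OF S(1), of x] fnn[OF S', of x]]])
          have "u \<ge> 0 \<Longrightarrow> w \<ge> 0 \<Longrightarrow> (u + w) / 2 \<le> u + w" for u w :: real by simp
          then show "(f S x + f (insert j S) x) / 2 \<le> f S x + f (insert j S) x"
            using fnn[OF S(1), of x] fnn[OF S', of x] by blast
        qed
        then show "AE x in lborel. norm (?q x) \<le> norm (f S x + f (insert j S) x)"
          using fnn[OF S(1)] fnn[OF S'] by (auto simp: abs_of_nonneg)
      qed
      have "1 - 1 / (4 * real n) \<le> 1 - (\<epsilon> j)\<^sup>2 / 4 * (\<integral>x. (V j x)\<^sup>2 / F0 x \<partial>lborel)"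
        using chi2 by simp
      also have "\<dots> = (\<integral>x. ?p x \<partial>lborel)"
      proof -
        have i: "integrable lborel (\<lambda>x. (f S x + f (insert j S) x) / 2)"
          "integrable lborel (\<lambda>x. (\<epsilon> j)\<^sup>2 / 4 * ((V j x)\<^sup>2 / F0 x))"
          by (intro integrable_divide_zero Bochner_Integration.integrable_add integrable_mult_right fi ivf)+
        have "(\<integral>x. (f S x + f (insert j S) x) / 2 \<partial>lborel) = 1"
          using fi intf(2)[OF S(1)] intf(2)[OF S'] by simp
        then show ?thesis
          unfolding Bochner_Integration.integral_diff[OF i] integral_mult_right_zero by simp
      qed
      also have "\<dots> \<le> (\<integral>x. ?q x \<partial>lborel)"
        by (rule integral_mono[OF _ qi pq])
           (intro Bochner_Integration.integrable_diff integrable_divide_zero Bochner_Integration.integrable_add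
             integrable_mult_right fi ivf)
      finally have "ennreal (1 - 1 / (4 * real n)) \<le> ennreal (\<integral>x. ?q x \<partial>lborel)" by (rule ennreal_leI)
      also have "\<dots> = (\<integral>\<^sup>+x. ennreal (?q x) \<partial>lborel)"
        by (rule nn_integral_eq_integral[symmetric, OF qi]) (use fnn[OF S(1)] fnn[OF S'] in auto)
      finally show ?thesis .
    qed
    show "?\<Delta> \<ge> 0" using pos by simp
  qed
  moreover have "real (card J) * ?\<Delta> / 8 = real (card I) ^ ?d * (a\<^sup>2 / b) ^ ?d / (8 * real n)"
    by (simp add: J)
  ultimately show ?thesis by simp
qed

section \<open>Residues in the upper half-plane\<close>

lemma lborel_integrable_Cauchy: "integrable lborel (\<lambda>x::real. 1 / (1 + x\<^sup>2))"
  and lborel_integral_Cauchy: "(\<integral>x. 1 / (1 + x\<^sup>2) \<partial>lborel) = pi"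
  using integrable_inverse_1_plus_square LBINT_inverse_1_plus_square
  by (simp_all add: interval_lebesgue_integral_def set_integrable_def set_lebesgue_integral_def inverse_eq_divide)

lemma tendsto_symmetric_integral:
  fixes f :: "real \<Rightarrow> complex"
  assumes "integrable lborel f"
  shows "(\<lambda>n. integral {- real n .. real n} f) \<longlonglongrightarrow> (\<integral>x. f x \<partial>lborel)"
proof -
  have m[measurable]: "f \<in> borel_measurable borel" using assms by auto
  have "(\<lambda>n. (\<integral>x. indicator {- real n .. real n} x *\<^sub>R f x \<partial>lborel)) \<longlonglongrightarrow> (\<integral>x. f x \<partial>lborel)"
  proof (rule integral_dominated_convergence)
    show "AE x in lborel. (\<lambda>n. indicator {- real n .. real n} x *\<^sub>R f x) \<longlonglongrightarrow> f x"
    proof (rule AE_I2)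
      fix x :: real
      obtain N where N: "\<bar>x\<bar> \<le> real N" using real_arch_simple by blast
      show "(\<lambda>n. indicator {- real n .. real n} x *\<^sub>R f x) \<longlonglongrightarrow> f x"
      proof (rule tendsto_eventually, rule eventually_sequentiallyI[of N])
        fix n assume "N \<le> n"
        then have "\<bar>x\<bar> \<le> real n" using N by linarith
        then show "indicator {- real n .. real n} x *\<^sub>R f x = f x" by (auto simp: indicator_def)
      qed
    qed
    show "integrable lborel (\<lambda>x. norm (f x))" using assms by simp
    show "AE x in lborel. norm (indicator {- real n .. real n} x *\<^sub>R f x) \<le> norm (f x)" for n
      by (auto simp: indicator_def)
  qed auto
  moreover have "(\<integral>x. indicator {- real n .. real n} x *\<^sub>R f x \<partial>lborel) = integral {- real n .. real n} f" for n
  proof -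
    have "set_integrable lborel {- real n .. real n} f"
      unfolding set_integrable_def using assms by (rule integrable_mult_indicator[rotated]) simp
    from set_borel_integral_eq_integral(2)[OF this] show ?thesis
      by (simp add: set_lebesgue_integral_def)
  qed
  ultimately show ?thesis by simp
qed

text \<open>
  The contour of the residue computation. Its winding number around \<open>\<i>\<close> is never
  computed geometrically: it does not depend on the integrand, so the known integral of
  \<open>1 / (1 + x^2)\<close> determines its limit for large radii.
\<close>

definition half_disc_boundary :: "real \<Rightarrow> real \<Rightarrow> complex" where
  "half_disc_boundary R = linepath (of_real (-R)) (of_real R) +++ part_circlepath 0 R 0 pi"

text \<open>
  The decay of the integrand makes the contribution of the arc \<open>O(1 / R)\<close>.
\<close>

lemma half_disc_residue_bound:
  fixes f :: "complex \<Rightarrow> complex"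
  assumes U: "open U" "convex U" "{z. Im z \<ge> 0} \<subseteq> U" and f: "f holomorphic_on U"
    and bound: "\<And>z. Im z \<ge> 0 \<Longrightarrow> norm z \<ge> 2 \<Longrightarrow> norm (f z / (z - \<i>) ^ Suc k) \<le> C / (norm z)\<^sup>2"
    and C: "C \<ge> 0" and R: "R \<ge> 2"
  shows "norm (integral {-R..R} (\<lambda>x. f (of_real x) / (of_real x - \<i>) ^ Suc k)
      - winding_number (half_disc_boundary R) \<i> * (2 * pi * \<i> * (deriv ^^ k) f \<i> / fact k)) \<le> C * pi / R"
proof -
  let ?g = "\<lambda>z. f z / (z - \<i>) ^ Suc k"
  let ?l = "linepath (of_real (-R) :: complex) (of_real R)"
  let ?a = "part_circlepath 0 R 0 pi"
  let ?\<gamma> = "half_disc_boundary R"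
  have iU: "\<i> \<in> U" using U by auto
  have pl: "path_image ?l \<subseteq> {z. Im z = 0}"
    by (auto simp: closed_segment_def)
  have pa: "path_image ?a \<subseteq> {z. Im z \<ge> 0 \<and> norm z = R}"
  proof
    fix z assume "z \<in> path_image ?a"
    then obtain t where t: "z = of_real R * exp (\<i> * of_real t)" "0 \<le> t" "t \<le> pi"
      using R by (auto simp: path_image_part_circlepath)
    have "Im z = R * sin t" using t by (simp add: cis_conv_exp[symmetric] cis.sel)
    moreover have "norm z = R" using t R by (simp add: norm_mult)
    ultimately show "z \<in> {z. Im z \<ge> 0 \<and> norm z = R}" using t R by (simp add: sin_ge_zero)
  qed
  have ends: "pathfinish ?l = pathstart ?a" "pathfinish ?a = pathstart ?l"
    by (simp_all add: exp_pi_i mult.commute)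
  have path: "valid_path ?\<gamma>" "pathfinish ?\<gamma> = pathstart ?\<gamma>"
    unfolding half_disc_boundary_def using ends by (auto intro: valid_path_join)
  have parts: "path_image ?l \<subseteq> U - {\<i>}" "path_image ?a \<subseteq> U - {\<i>}"
  proof -
    have "path_image ?l \<subseteq> {z. Im z \<ge> 0} - {\<i>}" using pl by fastforce
    moreover have "path_image ?a \<subseteq> {z. Im z \<ge> 0} - {\<i>}" using pa R by auto
    ultimately show "path_image ?l \<subseteq> U - {\<i>}" "path_image ?a \<subseteq> U - {\<i>}" using U(3) by blast+
  qed
  have sub: "path_image ?\<gamma> \<subseteq> U - {\<i>}"
    unfolding half_disc_boundary_def using parts ends by (subst path_image_join) auto
  have holo: "?g holomorphic_on U - {\<i>}"
    by (intro holomorphic_intros holomorphic_on_subset[OF f]) auto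
  have "contour_integral ?\<gamma> ?g = 2 * pi * \<i> * (\<Sum>p\<in>{\<i>}. winding_number ?\<gamma> p * residue ?g p)"
  proof (rule Residue_theorem[OF U(1) convex_connected[OF U(2)] _ holo path sub])
    show "\<forall>z. z \<notin> U \<longrightarrow> winding_number ?\<gamma> z = 0"
      using winding_number_zero_outside[OF valid_path_imp_path[OF path(1)] U(2) path(2)] sub by auto
  qed simp
  also have "\<dots> = 2 * pi * \<i> * (winding_number ?\<gamma> \<i> * residue ?g \<i>)" by simp
  also have "residue ?g \<i> = (deriv ^^ k) f \<i> / fact k"
    by (rule residue_holomorphic_over_power[OF U(1) iU f])
  finally have res: "contour_integral ?\<gamma> ?g = winding_number ?\<gamma> \<i> * (2 * pi * \<i> * (deriv ^^ k) f \<i> / fact k)"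
    by simp
  have cont: "continuous_on (U - {\<i>}) ?g" by (rule holomorphic_on_imp_continuous_on[OF holo])
  have il: "?g contour_integrable_on ?l"
  proof (rule contour_integrable_continuous_linepath, rule continuous_on_subset[OF cont])
    show "closed_segment (of_real (-R)) (of_real R) \<subseteq> U - {\<i>}" using parts(1) by simp
  qed
  have ia: "?g contour_integrable_on ?a"
  proof (rule contour_integrable_continuous_part_circlepath, rule continuous_on_subset[OF cont])
    show "path_image ?a \<subseteq> U - {\<i>}" by (rule parts)
  qed
  have "contour_integral ?\<gamma> ?g = contour_integral ?l ?g + contour_integral ?a ?g"
    unfolding half_disc_boundary_def by (rule contour_integral_join[OF il ia]) auto
  also have "contour_integral ?l ?g = integral {-R..R} (\<lambda>x. ?g (of_real x))"
    by (subst contour_integral_linepath_Reals_eq) (use R in auto)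
  finally have "integral {-R..R} (\<lambda>x. ?g (of_real x)) - contour_integral ?\<gamma> ?g = - contour_integral ?a ?g" by simp
  moreover have "norm (contour_integral ?a ?g) \<le> (C / R\<^sup>2) * R * \<bar>pi - 0\<bar>"
  proof (rule contour_integral_bound_part_circlepath[OF ia])
    fix z assume "z \<in> path_image ?a"
    then have "Im z \<ge> 0" "norm z = R" using pa by auto
    then show "norm (?g z) \<le> C / R\<^sup>2" using bound[of z] R by auto
  qed (use C R in auto)
  moreover have "(C / R\<^sup>2) * R * \<bar>pi - 0\<bar> = C * pi / R" using R by (simp add: power2_eq_square)
  ultimately show ?thesis using res by (metis norm_minus_cancel)
qed

lemma half_disc_residue_limit:
  fixes f :: "complex \<Rightarrow> complex"
  assumes U: "open U" "convex U" "{z. Im z \<ge> 0} \<subseteq> U" and f: "f holomorphic_on U"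
    and bound: "\<And>z. Im z \<ge> 0 \<Longrightarrow> norm z \<ge> 2 \<Longrightarrow> norm (f z / (z - \<i>) ^ Suc k) \<le> C / (norm z)\<^sup>2"
    and C: "C \<ge> 0"
    and int: "integrable lborel (\<lambda>x::real. f (of_real x) / (of_real x - \<i>) ^ Suc k)"
  shows "(\<lambda>n. winding_number (half_disc_boundary (real n)) \<i> * (2 * pi * \<i> * (deriv ^^ k) f \<i> / fact k))
      \<longlonglongrightarrow> (\<integral>x. f (of_real x) / (of_real x - \<i>) ^ Suc k \<partial>lborel)"
proof -
  let ?h = "\<lambda>x::real. f (of_real x) / (of_real x - \<i>) ^ Suc k"
  let ?w = "\<lambda>n. winding_number (half_disc_boundary (real n)) \<i> * (2 * pi * \<i> * (deriv ^^ k) f \<i> / fact k)"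
  have "(\<lambda>n. integral {- real n..real n} ?h - ?w n) \<longlonglongrightarrow> 0"
  proof (rule Lim_null_comparison)
    show "\<forall>\<^sub>F n in sequentially. norm (integral {- real n..real n} ?h - ?w n) \<le> C * pi / real n"
      by (rule eventually_sequentiallyI[of 2], rule half_disc_residue_bound[OF U f bound C]) auto
    show "(\<lambda>n. C * pi / real n) \<longlonglongrightarrow> 0" by (rule lim_const_over_n)
  qed
  from tendsto_diff[OF tendsto_symmetric_integral[OF int] this] show ?thesis by simp
qed

lemma winding_number_half_disc_limit:
  "(\<lambda>n. winding_number (half_disc_boundary (real n)) \<i>) \<longlonglongrightarrow> 1"
proof -
  let ?f = "\<lambda>z::complex. 1 / (z + \<i>)"
  let ?U = "{z. Im z > -1}"
  have nz: "z + \<i> \<noteq> 0" if "Im z > -1" for z using that by (auto simp: complex_eq_iff)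
  have prod: "?f z / (z - \<i>) ^ Suc 0 = 1 / (z\<^sup>2 + 1)" for z :: complex
    by (simp add: power2_eq_square algebra_simps)
  have real: "?f (of_real x) / (of_real x - \<i>) ^ Suc 0 = of_real (1 / (1 + x\<^sup>2))" for x :: real
    unfolding prod by (simp add: add.commute)
  have "(\<lambda>n. winding_number (half_disc_boundary (real n)) \<i> * (2 * pi * \<i> * (deriv ^^ 0) ?f \<i> / fact 0))
      \<longlonglongrightarrow> (\<integral>x. ?f (of_real x) / (of_real x - \<i>) ^ Suc 0 \<partial>lborel)"
  proof (rule half_disc_residue_limit[where C = 2])
    show "open ?U" by (rule open_halfspace_Im_gt)
    show "convex ?U" by (rule convex_halfspace_Im_gt)
    show "{z. Im z \<ge> 0} \<subseteq> ?U" by auto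
    show "?f holomorphic_on ?U" using nz by (intro holomorphic_intros) auto
    show "norm (?f z / (z - \<i>) ^ Suc 0) \<le> 2 / (norm z)\<^sup>2" if "norm z \<ge> 2" for z
    proof -
      have "4 \<le> (norm z)\<^sup>2" using power_mono[OF that, of 2] by simp
      moreover have "(norm z)\<^sup>2 - 1 \<le> norm (z\<^sup>2 + 1)"
        using norm_diff_ineq[of "z\<^sup>2" 1] by (simp add: norm_power)
      ultimately have "norm (1 / (z\<^sup>2 + 1)) \<le> 1 / ((norm z)\<^sup>2 / 2)"
        unfolding norm_divide norm_one by (intro divide_left_mono mult_pos_pos) auto
      then show ?thesis unfolding prod by simp
    qed
    show "integrable lborel (\<lambda>x::real. ?f (of_real x) / (of_real x - \<i>) ^ Suc 0)"
      unfolding real using lborel_integrable_Cauchy by (rule integrable_of_real)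
  qed simp
  moreover have "(\<integral>x. ?f (of_real x) / (of_real x - \<i>) ^ Suc 0 \<partial>lborel) = of_real pi"
    unfolding real integral_complex_of_real lborel_integral_Cauchy ..
  ultimately have "(\<lambda>n. winding_number (half_disc_boundary (real n)) \<i> * of_real pi) \<longlonglongrightarrow> of_real pi"
    by simp
  from tendsto_divide[OF this tendsto_const[of "of_real pi"]] show ?thesis by simp
qed

lemma half_plane_residue:
  fixes f :: "complex \<Rightarrow> complex"
  assumes U: "open U" "convex U" "{z. Im z \<ge> 0} \<subseteq> U" and f: "f holomorphic_on U"
    and bound: "\<And>z. Im z \<ge> 0 \<Longrightarrow> norm z \<ge> 2 \<Longrightarrow> norm (f z / (z - \<i>) ^ Suc k) \<le> C / (norm z)\<^sup>2"
    and C: "C \<ge> 0"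
    and int: "integrable lborel (\<lambda>x::real. f (of_real x) / (of_real x - \<i>) ^ Suc k)"
  shows "(\<integral>x. f (of_real x) / (of_real x - \<i>) ^ Suc k \<partial>lborel) = 2 * pi * \<i> * (deriv ^^ k) f \<i> / fact k"
proof (rule LIMSEQ_unique[OF half_disc_residue_limit[OF assms]])
  show "(\<lambda>n. winding_number (half_disc_boundary (real n)) \<i> * (2 * pi * \<i> * (deriv ^^ k) f \<i> / fact k))
      \<longlonglongrightarrow> 2 * pi * \<i> * (deriv ^^ k) f \<i> / fact k"
    using tendsto_mult_right[OF winding_number_half_disc_limit, of "2 * pi * \<i> * (deriv ^^ k) f \<i> / fact k"]
    by simp
qed

section \<open>Student kernels applied to oscillating wave packets\<close>

text \<open>
  The factor \<open>exp (\<i> j z)\<close> is bounded in the upper half-plane, and the denominator makes the packet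
  integrable with Cauchy tails. The pole is put as far away as \<open>- 79 \<i>\<close> so that the envelope, once
  shifted by \<open>\<i>\<close> to \<open>1 / (80 - \<i> x)^2\<close>, is nearly constant on \<open>[-\<pi>, \<pi>]\<close>.
\<close>

definition wave_packet :: "nat \<Rightarrow> complex \<Rightarrow> complex" where
  "wave_packet j z = exp (\<i> * of_nat j * z) / (79 - \<i> * z)\<^sup>2"

definition student_const :: "nat \<Rightarrow> real" where
  "student_const r = Gamma (real r + 1) / (sqrt pi * Gamma (real r + 1/2))"

lemma student_const_pos: "student_const r > 0"
  unfolding student_const_def by (intro divide_pos_pos mult_pos_pos Gamma_real_pos) auto

lemma student_eq: "student r x = student_const r / (1 + x\<^sup>2) ^ Suc r"
proof -
  have "- int r - 1 = - int (Suc r)" by simp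
  then have "(1 + x\<^sup>2) powi (- int r - 1) = inverse ((1 + x\<^sup>2) ^ Suc r)"
    by (simp only: power_int_minus power_int_of_nat)
  then show ?thesis by (simp only: student_def student_const_def divide_inverse)
qed

lemma student_pos: "student r x > 0"
  unfolding student_eq by (intro divide_pos_pos student_const_pos zero_less_power) (smt (verit) zero_le_power2)

lemma student_measurable[measurable]: "student r \<in> borel_measurable borel"
  unfolding student_eq[abs_def] by measurable

lemma half_plane_neighbourhood: "open {z. Im z > -1}" "convex {z. Im z > -1}" "{z. Im z \<ge> 0} \<subseteq> {z. Im z > -1}"
  by (auto intro: open_halfspace_Im_gt convex_halfspace_Im_gt)

lemma norm_wave_packet: "norm (wave_packet j (of_real x)) = 1 / (79\<^sup>2 + x\<^sup>2)"
proof -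
  have "(norm (79 - \<i> * of_real x))\<^sup>2 = 79\<^sup>2 + x\<^sup>2"
    by (simp add: cmod_power2)
  moreover have "norm (exp (\<i> * of_nat j * of_real x)) = 1"
    by (simp add: norm_exp_eq_Re)
  ultimately show ?thesis by (simp add: wave_packet_def norm_divide norm_power)
qed

lemma norm_exp_upper: "Im z \<ge> 0 \<Longrightarrow> norm (exp (\<i> * of_nat j * z)) \<le> 1"
  by (simp add: norm_exp_eq_Re)

lemma norm_shift_upper:
  assumes "Im z \<ge> 0"
  shows "norm (79 - \<i> * z) \<ge> norm z" "norm (79 - \<i> * (of_real x + z)) \<ge> 1" "79 - \<i> * (of_real x + z) \<noteq> 0"
proof -
  have "(norm (79 - \<i> * z))\<^sup>2 = (79 + Im z)\<^sup>2 + (Re z)\<^sup>2" by (simp add: cmod_power2)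
  also have "\<dots> \<ge> (Im z)\<^sup>2 + (Re z)\<^sup>2"
    using assms by (intro add_right_mono power_mono) auto
  finally have "(norm z)\<^sup>2 \<le> (norm (79 - \<i> * z))\<^sup>2" by (simp add: cmod_power2)
  then show "norm (79 - \<i> * z) \<ge> norm z" by (rule power2_le_imp_le) simp
  have "1 \<le> Re (79 - \<i> * (of_real x + z))" using assms by simp
  also have "\<dots> \<le> norm (79 - \<i> * (of_real x + z))" by (rule complex_Re_le_cmod)
  finally show "norm (79 - \<i> * (of_real x + z)) \<ge> 1" .
  then show "79 - \<i> * (of_real x + z) \<noteq> 0" by auto
qed

lemma nonzero_shift: "Im z > -1 \<Longrightarrow> 79 - \<i> * (of_real x + z) \<noteq> 0" "Im z > -1 \<Longrightarrow> z + \<i> \<noteq> 0"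
  by (auto simp: complex_eq_iff)

lemma wave_packet_measurable[measurable]: "(\<lambda>x. wave_packet j (of_real x)) \<in> borel_measurable borel"
proof -
  have "continuous_on UNIV (\<lambda>x::real. wave_packet j (of_real x))"
    unfolding wave_packet_def using nonzero_shift(1)[of 0]
    by (intro continuous_intros) auto
  then show ?thesis by (rule borel_measurable_continuous_onI)
qed

lemma integrable_wave_packet: "integrable lborel (\<lambda>x. wave_packet j (of_real x))"
proof (rule Bochner_Integration.integrable_bound[OF lborel_integrable_Cauchy])
  show "AE x in lborel. norm (wave_packet j (of_real x)) \<le> norm (1 / (1 + x\<^sup>2))"
    unfolding norm_wave_packet by (auto intro!: AE_I2 divide_left_mono mult_pos_pos add_pos_nonneg)
qed simp

text \<open>
  Adding a multiple of a packet to a mixing density keeps its mass. There is no pole in the upper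
  half-plane; the residue formula is applied to the packet times \<open>z - \<i>\<close>, which vanishes at \<open>\<i>\<close>.
\<close>

lemma integral_wave_packet: "(\<integral>x. wave_packet j (of_real x) \<partial>lborel) = 0"
proof -
  let ?f = "\<lambda>z. wave_packet j z * (z - \<i>)"
  have eq: "?f z / (z - \<i>) ^ Suc 0 = wave_packet j z" if "z \<noteq> \<i>" for z using that by simp
  have "complex_of_real x \<noteq> \<i>" for x by (auto simp: complex_eq_iff)
  note eqr = eq[OF this]
  have "(\<integral>x. ?f (of_real x) / (of_real x - \<i>) ^ Suc 0 \<partial>lborel) = 2 * pi * \<i> * (deriv ^^ 0) ?f \<i> / fact 0"
  proof (rule half_plane_residue[OF half_plane_neighbourhood, where C = 1])
    show "?f holomorphic_on {z. Im z > -1}"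
      unfolding wave_packet_def using nonzero_shift(1)[of _ 0]
      by (intro holomorphic_intros) auto
    show "norm (?f z / (z - \<i>) ^ Suc 0) \<le> 1 / (norm z)\<^sup>2" if z: "Im z \<ge> 0" "norm z \<ge> 2" for z
    proof -
      have "z \<noteq> \<i>" using z by auto
      have "norm (wave_packet j z) \<le> 1 / (norm z)\<^sup>2"
        unfolding wave_packet_def norm_divide norm_power using z
        by (intro frac_le norm_exp_upper power_mono norm_shift_upper) auto
      then show ?thesis unfolding eq[OF \<open>z \<noteq> \<i>\<close>] .
    qed
    show "integrable lborel (\<lambda>x::real. ?f (of_real x) / (of_real x - \<i>) ^ Suc 0)"
      unfolding eqr by (rule integrable_wave_packet)
  qed simp
  then show ?thesis unfolding eqr by simp
qed

text \<open>
  What multiplies \<open>exp (\<i> j u)\<close> in the integrand after the pole \<open>(u - \<i>)^(r + 1)\<close> of the Student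
  kernel has been split off, with the packet centred at \<open>- x\<close>.
\<close>

definition cofactor :: "nat \<Rightarrow> real \<Rightarrow> complex \<Rightarrow> complex" where
  "cofactor r x u = 1 / ((79 - \<i> * (of_real x + u))\<^sup>2 * (u + \<i>) ^ Suc r)"

lemma cofactor_holomorphic: "cofactor r x holomorphic_on {z. Im z > -1}"
  unfolding cofactor_def[abs_def] using nonzero_shift by (intro holomorphic_intros) auto

lemma residue_integral_cofactor:
  "(\<integral>u. exp (\<i> * of_nat j * of_real u) * cofactor r x (of_real u) / (of_real u - \<i>) ^ Suc r \<partial>lborel)
    = 2 * pi * \<i> * (deriv ^^ r) (\<lambda>u. exp (\<i> * of_nat j * u) * cofactor r x u) \<i> / fact r"
proof (rule half_plane_residue[OF half_plane_neighbourhood, where C = 2])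
  let ?f = "\<lambda>u. exp (\<i> * of_nat j * u) * cofactor r x u"
  show "?f holomorphic_on {z. Im z > -1}"
    by (intro holomorphic_intros cofactor_holomorphic)
  have fac: "?f z / (z - \<i>) ^ Suc r
      = exp (\<i> * of_nat j * z) / (79 - \<i> * (of_real x + z))\<^sup>2 / (z\<^sup>2 + 1) ^ Suc r" for z
  proof -
    have "(z + \<i>) * (z - \<i>) = z\<^sup>2 + 1" by (simp add: power2_eq_square algebra_simps)
    then show ?thesis unfolding cofactor_def by (simp only: power_mult_distrib[symmetric] divide_divide_eq_left
        times_divide_eq_right mult.assoc mult_1_right)
  qed
  have le: "norm (?f z / (z - \<i>) ^ Suc r) \<le> 1 / norm ((z\<^sup>2 + 1) ^ Suc r)" if "Im z \<ge> 0" for z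
  proof -
    have "norm (exp (\<i> * of_nat j * z) / (79 - \<i> * (of_real x + z))\<^sup>2) \<le> 1 / 1"
      unfolding norm_divide norm_power
      by (intro frac_le norm_exp_upper that one_le_power norm_shift_upper) auto
    then show ?thesis unfolding fac norm_divide[of _ "(z\<^sup>2 + 1) ^ Suc r"]
      by (intro divide_right_mono) auto
  qed
  show "norm (?f z / (z - \<i>) ^ Suc r) \<le> 2 / (norm z)\<^sup>2" if z: "Im z \<ge> 0" "norm z \<ge> 2" for z
  proof -
    have 4: "4 \<le> (norm z)\<^sup>2" using power_mono[OF z(2), of 2] by simp
    have 1: "(norm z)\<^sup>2 - 1 \<le> norm (z\<^sup>2 + 1)"
      using norm_diff_ineq[of "z\<^sup>2" 1] by (simp add: norm_power)
    have "norm (z\<^sup>2 + 1) ^ 1 \<le> norm (z\<^sup>2 + 1) ^ Suc r"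
      using 1 4 by (intro power_increasing) auto
    then have "(norm z)\<^sup>2 / 2 \<le> norm ((z\<^sup>2 + 1) ^ Suc r)"
      using 1 4 unfolding norm_power power_one_right by linarith
    then have "1 / norm ((z\<^sup>2 + 1) ^ Suc r) \<le> 1 / ((norm z)\<^sup>2 / 2)"
      using 4 by (intro divide_left_mono mult_pos_pos) auto
    then show ?thesis using le[OF z(1)] by simp
  qed
  show "integrable lborel (\<lambda>u::real. ?f (of_real u) / (of_real u - \<i>) ^ Suc r)"
  proof (rule Bochner_Integration.integrable_bound[OF lborel_integrable_Cauchy])
    have "of_real u \<noteq> \<i>" "of_real u + \<i> \<noteq> 0" "79 - \<i> * (of_real x + of_real u) \<noteq> 0" for u :: real
      by (auto simp: complex_eq_iff)
    then have "continuous_on UNIV (\<lambda>u::real. ?f (of_real u) / (of_real u - \<i>) ^ Suc r)"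
      unfolding cofactor_def by (intro continuous_intros ballI) (simp_all del: power_Suc)
    then show "(\<lambda>u::real. ?f (of_real u) / (of_real u - \<i>) ^ Suc r) \<in> borel_measurable lborel"
      by (simp add: borel_measurable_continuous_onI)
    show "AE u in lborel. norm (?f (of_real u) / (of_real u - \<i>) ^ Suc r) \<le> norm (1 / (1 + u\<^sup>2))"
    proof (rule AE_I2)
      fix u :: real
      have r: "(complex_of_real u)\<^sup>2 + 1 = of_real (1 + u\<^sup>2)" by simp
      have "(1 + u\<^sup>2) ^ 1 \<le> (1 + u\<^sup>2) ^ Suc r" by (intro power_increasing) auto
      then have "1 / (1 + u\<^sup>2) ^ Suc r \<le> 1 / (1 + u\<^sup>2)"
        by (intro divide_left_mono mult_pos_pos zero_less_power add_pos_nonneg) auto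
      moreover have "norm (((complex_of_real u)\<^sup>2 + 1) ^ Suc r) = (1 + u\<^sup>2) ^ Suc r"
        unfolding r norm_power norm_of_real by simp
      ultimately show "norm (?f (of_real u) / (of_real u - \<i>) ^ Suc r) \<le> norm (1 / (1 + u\<^sup>2))"
        using le[of "of_real u"] by simp
    qed
  qed
qed simp

definition smoothed_packet :: "nat \<Rightarrow> nat \<Rightarrow> real \<Rightarrow> complex" where
  "smoothed_packet r j x = (\<integral>\<mu>. student r (x - \<mu>) *\<^sub>R wave_packet j (of_real \<mu>) \<partial>lborel)"

lemma smoothed_packet_residue:
  "smoothed_packet r j x = student_const r * cis (real j * x) *
    (2 * pi * \<i> * (deriv ^^ r) (\<lambda>u. exp (\<i> * of_nat j * u) * cofactor r x u) \<i> / fact r)"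
proof -
  let ?f = "\<lambda>u. exp (\<i> * of_nat j * of_real u) * cofactor r x (of_real u) / (of_real u - \<i>) ^ Suc r"
  have "smoothed_packet r j x = (\<integral>u. student r (x - (x + u)) *\<^sub>R wave_packet j (of_real (x + u)) \<partial>lborel)"
    unfolding smoothed_packet_def
    using lborel_integral_real_affine[of 1 "\<lambda>\<mu>. student r (x - \<mu>) *\<^sub>R wave_packet j (of_real \<mu>)" x] by simp
  also have "\<dots> = (\<integral>u. student_const r * cis (real j * x) * ?f u \<partial>lborel)"
  proof (rule Bochner_Integration.integral_cong[OF refl])
    fix u :: real
    let ?u = "complex_of_real u"
    have d: "(?u + \<i>) ^ Suc r * (?u - \<i>) ^ Suc r = of_real ((1 + u\<^sup>2) ^ Suc r)"
    proof -
      have "(?u + \<i>) * (?u - \<i>) = of_real (1 + u\<^sup>2)" by (simp add: power2_eq_square algebra_simps)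
      then show ?thesis by (simp only: power_mult_distrib[symmetric] of_real_power)
    qed
    have e: "exp (\<i> * of_nat j * of_real (x + u)) = cis (real j * x) * exp (\<i> * of_nat j * ?u)"
      by (simp add: cis_conv_exp exp_add[symmetric] algebra_simps)
    have "student r (x - (x + u)) *\<^sub>R wave_packet j (of_real (x + u))
        = of_real (student_const r) / of_real ((1 + u\<^sup>2) ^ Suc r) * wave_packet j (of_real (x + u))"
      by (simp add: student_eq scaleR_conv_of_real)
    also have "\<dots> = student_const r * cis (real j * x) * ?f u"
      unfolding d[symmetric] wave_packet_def e cofactor_def by (simp add: divide_inverse mult_ac)
    finally show "student r (x - (x + u)) *\<^sub>R wave_packet j (of_real (x + u)) = student_const r * cis (real j * x) * ?f u" .
  qed
  also have "\<dots> = student_const r * cis (real j * x) * (\<integral>u. ?f u \<partial>lborel)"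
    by (rule integral_mult_right_zero)
  finally show ?thesis unfolding residue_integral_cofactor .
qed

lemma higher_deriv_exp_ij:
  "(deriv ^^ i) (\<lambda>u. exp (\<i> * of_nat j * u)) \<i> = (\<i> * of_nat j) ^ i * of_real (exp (- real j))"
proof -
  have ex: "(deriv ^^ i) exp = (exp :: complex \<Rightarrow> complex)"
    by (induction i) (auto intro!: ext DERIV_imp_deriv DERIV_exp)
  have "(deriv ^^ i) (\<lambda>u. exp (\<i> * of_nat j * u)) \<i> = (\<i> * of_nat j) ^ i * (deriv ^^ i) exp (\<i> * of_nat j * \<i>)"
    by (rule higher_deriv_compose_linear[of exp UNIV UNIV]) (auto intro: holomorphic_intros)
  also have "\<i> * of_nat j * \<i> = of_real (- real j)" by (simp add: algebra_simps)
  finally show ?thesis unfolding ex by (simp only: exp_of_real)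
qed

text \<open>
  Cauchy's inequality on the unit circle around \<open>\<i>\<close>, which lies in the closed upper half-plane. The
  decay in \<open>x\<close> comes from the envelope.
\<close>

lemma cofactor_deriv_bound:
  "norm ((deriv ^^ k) (cofactor r x) \<i>) \<le> fact k * (2 / (1 + x\<^sup>2))"
proof -
  have sub: "cball \<i> 1 \<subseteq> {z. Im z \<ge> 0}"
  proof
    fix z assume "z \<in> cball \<i> 1"
    then have "norm (\<i> - z) \<le> 1" by (simp add: dist_norm)
    then have "\<bar>Im (\<i> - z)\<bar> \<le> 1" using abs_Im_le_cmod order_trans by blast
    then show "z \<in> {z. Im z \<ge> 0}" by auto
  qed
  then have sub': "cball \<i> 1 \<subseteq> {z. Im z > -1}" by auto
  have "norm ((deriv ^^ k) (cofactor r x) \<i>) \<le> fact k * (2 / (1 + x\<^sup>2)) / 1 ^ k"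
  proof (rule Cauchy_inequality)
    show "cofactor r x holomorphic_on ball \<i> 1"
      using ball_subset_cball sub' by (intro holomorphic_on_subset[OF cofactor_holomorphic]) blast
    show "continuous_on (cball \<i> 1) (cofactor r x)"
      by (intro holomorphic_on_imp_continuous_on holomorphic_on_subset[OF cofactor_holomorphic] sub')
    fix u assume u: "norm (\<i> - u) = 1"
    then have "u \<in> cball \<i> 1" by (simp add: dist_norm)
    then have Im: "Im u \<ge> 0" using sub by blast
    have Re: "\<bar>Re u\<bar> \<le> 1" using u abs_Re_le_cmod[of "\<i> - u"] by simp
    have "1 \<le> Im (u + \<i>)" using Im by simp
    also have "\<dots> \<le> norm (u + \<i>)" using abs_Im_le_cmod[of "u + \<i>"] by linarith
    finally have 1: "1 \<le> norm (u + \<i>) ^ Suc r" by (rule one_le_power)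
    have "(1 + x\<^sup>2) / 2 \<le> 79\<^sup>2 + (x + Re u)\<^sup>2"
    proof -
      have "2 * (x + Re u)\<^sup>2 + 2 * (Re u)\<^sup>2 \<ge> x\<^sup>2"
        using sum_squares_ge_zero[of "x + 2 * Re u" 0] by (simp add: power2_eq_square algebra_simps)
      moreover have "(Re u)\<^sup>2 \<le> 1" using Re by (simp add: abs_square_le_1)
      ultimately show ?thesis by simp
    qed
    also have "\<dots> \<le> (79 + Im u)\<^sup>2 + (x + Re u)\<^sup>2"
      using Im by (intro add_right_mono power_mono) auto
    also have "\<dots> = (norm (79 - \<i> * (of_real x + u)))\<^sup>2"
      by (simp add: cmod_power2) (simp add: power2_eq_square algebra_simps)
    finally have 2: "(1 + x\<^sup>2) / 2 \<le> (norm (79 - \<i> * (of_real x + u)))\<^sup>2" .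
    have "(1 + x\<^sup>2) / 2 * 1 \<le> (norm (79 - \<i> * (of_real x + u)))\<^sup>2 * norm (u + \<i>) ^ Suc r"
      by (rule mult_mono[OF 2 1]) auto
    moreover have "(1 + x\<^sup>2) > 0" by (intro add_pos_nonneg) auto
    ultimately have "1 / ((norm (79 - \<i> * (of_real x + u)))\<^sup>2 * norm (u + \<i>) ^ Suc r) \<le> 1 / ((1 + x\<^sup>2) / 2)"
      by (intro frac_le) auto
    then show "norm (cofactor r x u) \<le> 2 / (1 + x\<^sup>2)"
      unfolding cofactor_def norm_divide norm_mult norm_power norm_one by simp
  qed simp
  then show ?thesis by simp
qed

text \<open>
  The order of the Fourier transform of the Student kernel at frequency \<open>j\<close>.
\<close>

definition damping :: "nat \<Rightarrow> nat \<Rightarrow> real" where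
  "damping r j = real j ^ r * exp (- real j)"

text \<open>
  In the Leibniz expansion of the residue, the term in which all \<open>r\<close> derivatives fall on
  \<open>exp (\<i> j u)\<close> carries the full power \<open>j^r\<close>. Every other term has at least one power of \<open>j\<close> less,
  and is of the same size \<open>1 / (1 + x^2)\<close> in \<open>x\<close>, so it is smaller by the factor \<open>1 / j\<close> uniformly.
\<close>

lemma smoothed_packet_asymptotics:
  obtains \<kappa> D :: real where "\<kappa> > 0" "D \<ge> 0"
    "\<And>j x. j \<ge> 1 \<Longrightarrow> norm (smoothed_packet r j x - \<kappa> * damping r j * cis (real j * x) / (80 - \<i> * x)\<^sup>2)
      \<le> D * damping r j / (real j * (1 + x\<^sup>2))"
proof -
  define \<kappa> where "\<kappa> = student_const r * pi / (2 ^ r * fact r)"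
  define E :: real where "E = (\<Sum>i<r. real (r choose i) * (fact (r - i) * 2))"
  define D where "D = student_const r * 2 * pi / fact r * E"
  have E0: "E \<ge> 0" unfolding E_def by (intro sum_nonneg) auto
  show thesis
  proof
    show "\<kappa> > 0" unfolding \<kappa>_def by (intro divide_pos_pos mult_pos_pos student_const_pos) auto
    show "D \<ge> 0" unfolding D_def using E0 student_const_pos[of r] by simp
    fix j :: nat and x :: real assume j: "j \<ge> 1"
    let ?t = "\<lambda>i. of_nat (r choose i) * ((\<i> * of_nat j) ^ i * of_real (exp (- real j))) * (deriv ^^ (r - i)) (cofactor r x) \<i>"
    let ?p = "student_const r * cis (real j * x) * (2 * pi * \<i> / fact r)"
    have "(deriv ^^ r) (\<lambda>u. exp (\<i> * of_nat j * u) * cofactor r x u) \<i> = (\<Sum>i = 0..r. ?t i)"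
      by (subst higher_deriv_mult[OF _ cofactor_holomorphic])
         (auto intro!: holomorphic_intros open_halfspace_Im_gt simp: higher_deriv_exp_ij)
    also have "\<dots> = ?t r + (\<Sum>i<r. ?t i)"
      by (simp add: atLeast0AtMost lessThan_Suc_atMost[symmetric])
    finally have dd: "(deriv ^^ r) (\<lambda>u. exp (\<i> * of_nat j * u) * cofactor r x u) \<i> = ?t r + (\<Sum>i<r. ?t i)" .
    have exp: "smoothed_packet r j x = ?p * ?t r + ?p * (\<Sum>i<r. ?t i)"
    proof -
      have "smoothed_packet r j x = ?p * (?t r + (\<Sum>i<r. ?t i))"
        unfolding smoothed_packet_residue dd by (simp only: times_divide_eq_right times_divide_eq_left mult.assoc)
      then show ?thesis by (simp only: distrib_left)
    qed
    have i: "79 - \<i> * (of_real x + \<i>) = 80 - \<i> * x" by (simp add: algebra_simps)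
    have main: "?p * ?t r = \<kappa> * damping r j * cis (real j * x) / (80 - \<i> * x)\<^sup>2"
    proof -
      have "(2 * \<i>) * \<i> ^ r / (2 * \<i>) ^ Suc r = (1 / 2 ^ r :: complex)"
        by (simp add: power_mult_distrib)
      then have "?p * ?t r = student_const r * cis (real j * x) * (pi / fact r) * (1 / 2 ^ r) * damping r j / (80 - \<i> * x)\<^sup>2"
        unfolding cofactor_def by (simp only: funpow_0 diff_self_eq_0) (simp add: i damping_def power_mult_distrib field_simps)
      then show ?thesis unfolding \<kappa>_def by (simp add: field_simps)
    qed
    have "norm (\<Sum>i<r. ?t i) \<le> (\<Sum>i<r. real (r choose i) * (fact (r - i) * 2) * (damping r j / (real j * (1 + x\<^sup>2))))"
    proof (rule order_trans[OF norm_sum sum_mono])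
      fix i assume "i \<in> {..<r}"
      then have i: "i < r" by simp
      have p: "real j ^ i \<le> real j ^ r / real j"
      proof -
        have "real j ^ i * real j \<le> real j ^ r"
          using power_increasing[of "Suc i" r "real j"] i j by (simp add: mult.commute)
        then show ?thesis using j by (simp add: field_simps)
      qed
      have "norm (?t i) = real (r choose i) * (real j ^ i * exp (- real j)) * norm ((deriv ^^ (r - i)) (cofactor r x) \<i>)"
        by (simp add: norm_mult norm_power)
      also have "\<dots> \<le> real (r choose i) * (real j ^ r / real j * exp (- real j)) * (fact (r - i) * (2 / (1 + x\<^sup>2)))"
        by (intro mult_mono order_refl p cofactor_deriv_bound) auto
      also have "\<dots> = real (r choose i) * (fact (r - i) * 2) * (damping r j / (real j * (1 + x\<^sup>2)))"
        by (simp add: damping_def)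
      finally show "norm (?t i) \<le> \<dots>" .
    qed
    also have "\<dots> = E * (damping r j / (real j * (1 + x\<^sup>2)))"
      unfolding E_def by (rule sum_distrib_right[symmetric])
    finally have "norm (?p * (\<Sum>i<r. ?t i)) \<le> student_const r * 2 * pi / fact r * (E * (damping r j / (real j * (1 + x\<^sup>2))))"
      unfolding norm_mult[of ?p]
      using student_const_pos[of r] by (intro mult_mono) (auto simp: norm_mult norm_divide)
    then show "norm (smoothed_packet r j x - \<kappa> * damping r j * cis (real j * x) / (80 - \<i> * x)\<^sup>2)
      \<le> D * damping r j / (real j * (1 + x\<^sup>2))"
      unfolding exp main D_def by (simp add: mult.assoc)
  qed
qed

section \<open>The one-dimensional estimates\<close>

lemma inverse_power_le_Cauchy: "1 / (1 + x\<^sup>2) ^ Suc k \<le> 1 / (1 + x\<^sup>2 :: real)"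
proof -
  have "(1 + x\<^sup>2) ^ 1 \<le> (1 + x\<^sup>2) ^ Suc k" by (intro power_increasing) auto
  moreover have "1 + x\<^sup>2 > 0" by (intro add_pos_nonneg) auto
  ultimately show ?thesis by (intro frac_le) auto
qed

lemma integrable_inverse_power: "integrable lborel (\<lambda>x::real. 1 / (1 + x\<^sup>2) ^ Suc k)"
proof (rule Bochner_Integration.integrable_bound[OF lborel_integrable_Cauchy])
  show "AE x in lborel. norm (1 / (1 + x\<^sup>2) ^ Suc k) \<le> norm (1 / (1 + x\<^sup>2 :: real))"
    using inverse_power_le_Cauchy by (intro AE_I2) (simp add: abs_of_nonneg del: power_Suc)
qed simp

text \<open>
  The derivative of \<open>x / (1 + x^2)^(k + 1)\<close> is the difference of the two integrands with their factors,
  and this function vanishes at both ends of the line.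
\<close>

lemma integral_inverse_power_Suc:
  "real (2 * k + 2) * (\<integral>x. 1 / (1 + x\<^sup>2) ^ Suc (Suc k) \<partial>lborel)
    = real (2 * k + 1) * (\<integral>x. 1 / (1 + x\<^sup>2 :: real) ^ Suc k \<partial>lborel)"
proof -
  let ?F = "\<lambda>x::real. x / (1 + x\<^sup>2) ^ Suc k"
  let ?f = "\<lambda>x::real. real (2 * k + 2) * (1 / (1 + x\<^sup>2) ^ Suc (Suc k)) - real (2 * k + 1) * (1 / (1 + x\<^sup>2) ^ Suc k)"
  have p: "1 + x\<^sup>2 \<noteq> 0" for x :: real by (smt (verit) zero_le_power2)
  have der: "(?F has_real_derivative ?f x) (at x)" for x
  proof -
    have "(?F has_real_derivative ((1 + x\<^sup>2) ^ Suc k - x * (real (Suc k) * (1 + x\<^sup>2) ^ k * (2 * x))) / ((1 + x\<^sup>2) ^ Suc k * (1 + x\<^sup>2) ^ Suc k)) (at x)"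
      by (rule derivative_eq_intros refl | use p in simp)+
    also have "((1 + x\<^sup>2) ^ Suc k - x * (real (Suc k) * (1 + x\<^sup>2) ^ k * (2 * x))) / ((1 + x\<^sup>2) ^ Suc k * (1 + x\<^sup>2) ^ Suc k) = ?f x"
    proof -
      define q where "q = 1 + x\<^sup>2"
      have q: "q \<noteq> 0" "x * x = q - 1" using p by (auto simp: q_def power2_eq_square)
      have "x * (real (Suc k) * q ^ k * (2 * x)) = real (Suc k) * q ^ k * 2 * (q - 1)"
        unfolding q(2)[symmetric] by (simp only: mult_ac)
      then have num: "q ^ Suc k - x * (real (Suc k) * q ^ k * (2 * x)) = q ^ k * (real (2 * k + 2) - real (2 * k + 1) * q)"
        by (simp add: algebra_simps)
      have cancel: "q ^ k * (u - w * q) / (q ^ Suc k * q ^ Suc k) = u * (1 / q ^ Suc (Suc k)) - w * (1 / q ^ Suc k)" for u w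
        using q(1) by (simp add: field_simps)
      show ?thesis unfolding q_def[symmetric] num by (rule cancel)
    qed
    finally show ?thesis .
  qed
  have int: "integrable lborel ?f"
    by (intro Bochner_Integration.integrable_diff integrable_mult_right integrable_inverse_power)
  have lim: "(?F \<longlongrightarrow> 0) at_top" "(?F \<longlongrightarrow> 0) at_bot"
  proof -
    have le: "norm (?F x) \<le> norm (1 / x)" for x :: real
    proof (cases "x = 0")
      case False
      have "norm (?F x) = \<bar>x\<bar> * (1 / (1 + x\<^sup>2) ^ Suc k)" by (simp add: abs_mult power_abs abs_of_nonneg)
      also have "\<dots> \<le> \<bar>x\<bar> * (1 / (1 + x\<^sup>2))" by (intro mult_left_mono inverse_power_le_Cauchy) auto
      also have "\<dots> \<le> \<bar>x\<bar> * (1 / x\<^sup>2)" using False by (intro mult_left_mono divide_left_mono) (auto intro!: mult_pos_pos add_pos_nonneg)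
      also have "\<dots> = norm (1 / x)" using False by (simp add: abs_if power2_eq_square)
      finally show ?thesis .
    qed simp
    have inv: "((\<lambda>x::real. 1 / x) \<longlongrightarrow> 0) at_top" "((\<lambda>x::real. 1 / x) \<longlongrightarrow> 0) at_bot" by real_asymp+
    have le': "\<forall>\<^sub>F x in F. norm (?F x) \<le> norm (1 / x) * 1" for F
      unfolding mult_1_right by (rule always_eventually) (rule allI[OF le])
    show "(?F \<longlongrightarrow> 0) at_top" "(?F \<longlongrightarrow> 0) at_bot"
      by (rule tendsto_0_le[OF inv(1) le'], rule tendsto_0_le[OF inv(2) le'])
  qed
  have "(LBINT x=-\<infinity>..\<infinity>. ?f x) = 0 - 0"
  proof (rule interval_integral_FTC_integrable)
    show "(?F has_vector_derivative ?f x) (at x)" for x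
      using der[of x] by (simp only: has_real_derivative_iff_has_vector_derivative)
    show "isCont ?f x" for x using p by (intro continuous_intros) auto
    show "set_integrable lborel (einterval (- \<infinity>) \<infinity>) ?f" using int by (simp add: set_integrable_def)
    show "((?F \<circ> real_of_ereal) \<longlongrightarrow> 0) (at_right (- \<infinity>))"
      using lim(2) by (simp add: ereal_tendsto_simps)
    show "((?F \<circ> real_of_ereal) \<longlongrightarrow> 0) (at_left \<infinity>)"
      using lim(1) by (simp add: ereal_tendsto_simps)
  qed simp
  then have "(\<integral>x. ?f x \<partial>lborel) = 0"
    by (simp add: interval_lebesgue_integral_def set_lebesgue_integral_def)
  then show ?thesis
    unfolding Bochner_Integration.integral_diff[OF integrable_mult_right[OF integrable_inverse_power]
        integrable_mult_right[OF integrable_inverse_power]] integral_mult_right_zero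
    by linarith
qed

lemma student_const_0: "student_const 0 = 1 / pi"
  by (simp add: student_const_def Gamma_one_half_real)

lemma integrable_student: "integrable lborel (student r)"
  unfolding student_eq[abs_def] using integrable_mult_right[OF integrable_inverse_power, of "student_const r" r]
  by simp

text \<open>
  Both the integral and the normalising constant follow the same recursion in \<open>r\<close>, by the previous
  lemma and by \<open>Gamma_plus1\<close>.
\<close>

lemma integral_student: "(\<integral>x. student r x \<partial>lborel) = 1"
proof -
  have s: "(\<integral>x. student r x \<partial>lborel) = student_const r * (\<integral>x. 1 / (1 + x\<^sup>2) ^ Suc r \<partial>lborel)" for r
    unfolding student_eq by (subst integral_mult_right_zero[symmetric]) simp
  show ?thesis
  proof (induction r)
    case 0
    show ?case unfolding s student_const_0 by (simp add: lborel_integral_Cauchy)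
  next
    case (Suc r)
    have nz: "real r + 1 \<notin> \<int>\<^sub>\<le>\<^sub>0" "real r + 1/2 \<notin> \<int>\<^sub>\<le>\<^sub>0"
      using nonpos_Ints_nonpos[of "real r + 1"] nonpos_Ints_nonpos[of "real r + 1/2"] by force+
    have "student_const (Suc r) = student_const r * ((real r + 1) / (real r + 1/2))"
    proof -
      have "real (Suc r) + 1 = (real r + 1) + 1" "real (Suc r) + 1/2 = (real r + 1/2) + 1" by simp_all
      then show ?thesis unfolding student_const_def
        by (simp only: Gamma_plus1[OF nz(1)] Gamma_plus1[OF nz(2)]) (simp add: mult_ac)
    qed
    also have "(real r + 1) / (real r + 1/2) = real (2 * r + 2) / real (2 * r + 1)"
      by (simp add: field_simps)
    finally have "(\<integral>x. student (Suc r) x \<partial>lborel)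
        = student_const r * (real (2 * r + 2) * (\<integral>x. 1 / (1 + x\<^sup>2) ^ Suc (Suc r) \<partial>lborel)) / real (2 * r + 1)"
      unfolding s by (simp del: power_Suc of_nat_add)
    also have "\<dots> = 1"
      unfolding integral_inverse_power_Suc using Suc unfolding s by (simp del: power_Suc of_nat_add)
    finally show ?case .
  qed
qed

lemma student_le: "student r x \<le> student_const r"
proof -
  have "1 \<le> (1 + x\<^sup>2) ^ Suc r" by (intro one_le_power) auto
  then show ?thesis unfolding student_eq using student_const_pos[of r]
    by (simp add: divide_le_eq mult_le_cancel_left1 del: power_Suc)
qed

definition base_density :: "nat \<Rightarrow> real \<Rightarrow> real" where
  "base_density r = conv (student r) (student 0)"

text \<open>
  The Cauchy tails of the mixing density are inherited by the mixture, whatever \<open>r\<close> is. This is why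
  the mixing density is Cauchy: the convolved packets also decay like \<open>1 / (1 + x^2)\<close>, so
  their chi-square norms are finite.
\<close>

lemma base_density_lower:
  obtains c where "c > 0" "\<And>x. c / (1 + x\<^sup>2) \<le> base_density r x"
proof
  \<comment> \<open>only the \<open>\<mu>\<close> within distance \<open>1\<close> of \<open>x\<close> are used; there the kernel is at least \<open>A\<close>\<close>
  define A where "A = student_const r / 2 ^ Suc r"
  define c where "c = 2 * A * student_const 0 / 3"
  have A: "A > 0" unfolding A_def using student_const_pos by simp
  show "c > 0" unfolding c_def using A student_const_pos by simp
  fix x :: real
  have p: "1 + y\<^sup>2 > 0" for y :: real by (intro add_pos_nonneg) auto
  have int: "integrable lborel (\<lambda>\<mu>. student r (x - \<mu>) * student 0 \<mu>)"
    by (rule integrable_conv_integrand[where B = "student_const r"])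
       (use student_le student_pos integrable_student in \<open>auto simp: abs_of_pos\<close>)
  have "c / (1 + x\<^sup>2) = (\<integral>\<mu>. A * student_const 0 / (3 * (1 + x\<^sup>2)) * indicator {x-1..x+1} \<mu> \<partial>lborel)"
    by (simp add: c_def)
  also have "\<dots> \<le> (\<integral>\<mu>. student r (x - \<mu>) * student 0 \<mu> \<partial>lborel)"
  proof (rule integral_mono[OF _ int])
    show "integrable lborel (\<lambda>\<mu>. A * student_const 0 / (3 * (1 + x\<^sup>2)) * indicator {x-1..x+1} \<mu> :: real)"
      by simp
    fix \<mu>
    show "A * student_const 0 / (3 * (1 + x\<^sup>2)) * indicator {x-1..x+1} \<mu> \<le> student r (x - \<mu>) * student 0 \<mu>"
    proof (cases "\<mu> \<in> {x-1..x+1}")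
      case True
      then have d: "(x - \<mu>)\<^sup>2 \<le> 1" by (simp add: abs_square_le_1 abs_le_iff)
      then have "(1 + (x - \<mu>)\<^sup>2) ^ Suc r \<le> 2 ^ Suc r" by (intro power_mono) auto
      then have 1: "A \<le> student r (x - \<mu>)"
        unfolding A_def student_eq using student_const_pos[of r] p by (intro frac_le zero_less_power) auto
      have "\<mu>\<^sup>2 \<le> 2 * x\<^sup>2 + 2 * (x - \<mu>)\<^sup>2"
        using zero_le_power2[of "2 * x - \<mu>"] by (simp add: power2_eq_square algebra_simps)
      then have "1 + \<mu>\<^sup>2 \<le> 3 * (1 + x\<^sup>2)" using d zero_le_power2[of x] unfolding distrib_left by linarith
      then have 2: "student_const 0 / (3 * (1 + x\<^sup>2)) \<le> student 0 \<mu>"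
        unfolding student_eq using student_const_pos[of 0] p by (intro frac_le) auto
      have "A * (student_const 0 / (3 * (1 + x\<^sup>2))) \<le> student r (x - \<mu>) * student 0 \<mu>"
        using A student_const_pos[of 0] student_pos[of r] p[of x] by (intro mult_mono 1 2) (auto simp: less_imp_le)
      then show ?thesis using True by simp
    next
      case False
      then show ?thesis using student_pos[of r "x - \<mu>"] student_pos[of 0 \<mu>] by simp
    qed
  qed
  finally show "c / (1 + x\<^sup>2) \<le> base_density r x" by (simp add: base_density_def conv_def)
qed

definition direction :: "nat \<Rightarrow> real \<Rightarrow> real" where
  "direction j x = Re (wave_packet j (of_real x))"

lemma direction_measurable[measurable]: "direction j \<in> borel_measurable borel"
  unfolding direction_def[abs_def] by measurable

lemma direction_bound: "\<bar>direction j x\<bar> \<le> pi * student 0 x"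
proof -
  have "\<bar>direction j x\<bar> \<le> 1 / (79\<^sup>2 + x\<^sup>2)"
    using abs_Re_le_cmod[of "wave_packet j (of_real x)"] unfolding direction_def norm_wave_packet .
  also have "\<dots> \<le> 1 / (1 + x\<^sup>2)" by (intro divide_left_mono) (auto intro!: mult_pos_pos add_pos_nonneg)
  finally show ?thesis by (simp add: student_eq student_const_0)
qed

lemma integrable_direction: "integrable lborel (direction j)"
  unfolding direction_def[abs_def] by (intro integrable_Re integrable_wave_packet)

lemma integral_direction: "(\<integral>x. direction j x \<partial>lborel) = 0"
  unfolding direction_def using integral_Re[OF integrable_wave_packet, of j] by (simp add: integral_wave_packet)

lemma conv_direction: "conv (student r) (direction j) x = Re (smoothed_packet r j x)"
proof -
  have "integrable lborel (\<lambda>\<mu>. student r (x - \<mu>) *\<^sub>R wave_packet j (of_real \<mu>))"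
  proof (rule Bochner_Integration.integrable_bound)
    show "integrable lborel (\<lambda>\<mu>. student_const r * norm (wave_packet j (of_real \<mu>)))"
      by (intro integrable_mult_right integrable_norm integrable_wave_packet)
    show "AE \<mu> in lborel. norm (student r (x - \<mu>) *\<^sub>R wave_packet j (of_real \<mu>)) \<le> norm (student_const r * norm (wave_packet j (of_real \<mu>)))"
      using student_le[of r] student_pos[of r] student_const_pos[of r]
      by (intro AE_I2) (auto simp: abs_of_pos intro!: mult_right_mono)
  qed measurable
  from integral_Re[OF this] show ?thesis
    by (simp add: conv_def smoothed_packet_def direction_def)
qed

lemma cos_integral_zero:
  assumes "k \<noteq> 0"
  shows "has_bochner_integral lborel (\<lambda>x. cos (real_of_int k * x) * indicator {-pi..pi} x) 0"
proof -
  have "has_bochner_integral lborel (\<lambda>x. cos (real_of_int k * x) * indicator {-pi..pi} x)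
    (sin (real_of_int k * pi) / real_of_int k - sin (real_of_int k * (- pi)) / real_of_int k)"
    by (rule has_bochner_integral_FTC_Icc_real)
       (use assms in \<open>auto intro!: derivative_eq_intros continuous_intros\<close>)
  moreover have "sin (real_of_int k * pi) = 0" by (simp add: sin_zero_iff_int2)
  ultimately show ?thesis by simp
qed

definition trig :: "nat \<Rightarrow> real \<Rightarrow> real" where
  "trig j x = indicator {-pi..pi} x * cos (real j * x) / sqrt pi"

lemma trig_measurable[measurable]: "trig j \<in> borel_measurable borel"
  unfolding trig_def[abs_def] by measurable

lemma trig_bound: "\<bar>trig j x\<bar> \<le> 1"
proof -
  have "\<bar>trig j x\<bar> \<le> \<bar>cos (real j * x)\<bar> / sqrt pi" by (simp add: trig_def indicator_def)
  also have "\<dots> \<le> 1 / 1" using pi_gt3 by (intro frac_le) auto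
  finally show ?thesis by simp
qed

lemma trig_orthonormal:
  assumes "i > 0" "j > 0"
  shows "integrable lborel (\<lambda>x. trig i x * trig j x)"
    "(\<integral>x. trig i x * trig j x \<partial>lborel) = (if i = j then 1 else 0)"
proof -
  let ?c = "\<lambda>k x. cos (real_of_int k * x) * indicator {-pi..pi} x"
  have prod: "trig i x * trig j x = (?c (int i - int j) x + ?c (int i + int j) x) / (2 * pi)" for x
    by (simp add: trig_def cos_diff cos_add ring_distribs indicator_def)
  have d: "has_bochner_integral lborel (?c (int i - int j)) (if i = j then 2 * pi else 0)"
  proof (cases "i = j")
    case True
    have "has_bochner_integral lborel (indicator {-pi..pi} :: real \<Rightarrow> real) (measure lborel {-pi..pi})"
      by (rule has_bochner_integral_real_indicator) auto
    then show ?thesis using True by simp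
  next
    case False
    then show ?thesis using cos_integral_zero[of "int i - int j"] by simp
  qed
  have s: "has_bochner_integral lborel (?c (int i + int j)) 0"
    by (rule cos_integral_zero) (use assms in auto)
  have "has_bochner_integral lborel (\<lambda>x. trig i x * trig j x) (((if i = j then 2 * pi else 0) + 0) / (2 * pi))"
    unfolding prod by (intro has_bochner_integral_divide_zero has_bochner_integral_add d s)
  then show "integrable lborel (\<lambda>x. trig i x * trig j x)"
    "(\<integral>x. trig i x * trig j x \<partial>lborel) = (if i = j then 1 else 0)"
    by (auto simp: has_bochner_integral_iff)
qed

lemma damping_pos: "j \<ge> 1 \<Longrightarrow> damping r j > 0"
  by (simp add: damping_def)

text \<open>
  Here \<open>6400 = 80^2\<close>. The error is about \<open>2 \<bar>x\<bar> / 80\<close>.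
\<close>

lemma envelope_almost_constant:
  fixes x :: real
  assumes "\<bar>x\<bar> \<le> pi"
  shows "norm (6400 / (80 - \<i> * x)\<^sup>2 - 1) \<le> 1 / 8"
proof -
  have n: "(norm (80 - \<i> * x))\<^sup>2 = 6400 + x\<^sup>2" by (simp add: cmod_power2)
  then have nz: "80 - \<i> * x \<noteq> 0" by (smt (verit) norm_zero zero_power2 zero_le_power2)
  have "6400 / (80 - \<i> * x)\<^sup>2 - 1 = (160 * \<i> * x + x\<^sup>2) / (80 - \<i> * x)\<^sup>2"
  proof -
    have "6400 - (80 - \<i> * x)\<^sup>2 = 160 * \<i> * x + x\<^sup>2" by (simp add: power2_eq_square algebra_simps)
    moreover have "6400 / w - 1 = (6400 - w) / w" if "w \<noteq> 0" for w :: complex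
      using that by (simp add: diff_divide_distrib)
    ultimately show ?thesis using nz by simp
  qed
  also have "norm \<dots> = norm (160 * \<i> * x + (of_real x)\<^sup>2) / (6400 + x\<^sup>2)"
    by (simp add: norm_divide norm_power n)
  also have "\<dots> \<le> (160 * \<bar>x\<bar> + x\<^sup>2) / 6400"
    by (intro frac_le order_trans[OF norm_triangle_ineq]) (auto simp: norm_mult norm_power)
  also have "\<dots> \<le> (160 * 4 + 4\<^sup>2) / 6400"
  proof -
    have "\<bar>x\<bar> \<le> 4" using assms pi_less_4 by linarith
    moreover from this have "x\<^sup>2 \<le> 4\<^sup>2" using power_mono[of "\<bar>x\<bar>" 4 2] by simp
    ultimately show ?thesis by (intro divide_right_mono add_mono) auto
  qed
  finally show ?thesis by simp
qed

text \<open>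
  Signal and noise at frequency \<open>j\<close>. On \<open>[-\<pi>, \<pi>]\<close> the convolved packet is a constant multiple of
  \<open>damping r j\<close> times \<open>cos (j x)\<close>, up to a quarter of this amplitude: one half of the error comes
  from the envelope and the other half from the asymptotics, if \<open>j \<ge> j0\<close>. Since the integral of
  \<open>cos^2 - 1/4\<close> over \<open>[-\<pi>, \<pi>]\<close> is positive, the coefficient is of the order \<open>damping r j\<close>. The
  chi-square norm is of at most this order on the whole line.
\<close>

lemma one_dimensional_estimates:
  obtains a b :: real and j0 :: nat where "a > 0" "b > 0" "j0 \<ge> 1"
    "\<And>j. j \<ge> j0 \<Longrightarrow> integrable lborel (\<lambda>x. (conv (student r) (direction j) x)\<^sup>2 / base_density r x)"
    "\<And>j. j \<ge> j0 \<Longrightarrow> (\<integral>x. (conv (student r) (direction j) x)\<^sup>2 / base_density r x \<partial>lborel) \<le> b * (damping r j)\<^sup>2"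
    "\<And>j. j \<ge> j0 \<Longrightarrow> (\<integral>x. conv (student r) (direction j) x * trig j x \<partial>lborel) \<ge> a * damping r j"
proof -
  obtain \<kappa> D where \<kappa>: "\<kappa> > 0" and D: "D \<ge> 0" and
    as: "\<And>j x. j \<ge> 1 \<Longrightarrow> norm (smoothed_packet r j x - \<kappa> * damping r j * cis (real j * x) / (80 - \<i> * x)\<^sup>2)
      \<le> D * damping r j / (real j * (1 + x\<^sup>2))"
    using smoothed_packet_asymptotics by blast
  obtain c where c: "c > 0" "\<And>x. c / (1 + x\<^sup>2) \<le> base_density r x" using base_density_lower by blast
  \<comment> \<open>\<open>51200 = 8 * 80^2\<close>: from \<open>j0\<close> on the asymptotic error is at most an eighth of the main term\<close>
  define j0 where "j0 = max 1 (nat \<lceil>51200 * D / \<kappa>\<rceil>)"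
  define B where "B = \<kappa> + D"
  define a where "a = \<kappa> * sqrt pi / 12800"
  define b where "b = B\<^sup>2 / c * pi"
  let ?v = "\<lambda>j. conv (student r) (direction j)"
  have p: "1 + x\<^sup>2 > 0" for x :: real by (intro add_pos_nonneg) auto
  have bd: "base_density r x > 0" for x using c(2)[of x] c(1) p[of x] by (smt (verit) divide_pos_pos)
  have vi: "integrable lborel (?v j)" for j
    by (intro integrable_conv integrable_student integrable_direction)
  have bi: "integrable lborel (base_density r)"
    unfolding base_density_def by (intro integrable_conv integrable_student)
  have v_le: "\<bar>?v j x\<bar> \<le> B * damping r j / (1 + x\<^sup>2)" if "j \<ge> 1" for j x
  proof -
    have n: "(norm (80 - \<i> * x))\<^sup>2 = 6400 + x\<^sup>2" by (simp add: cmod_power2)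
    have "\<bar>?v j x\<bar> \<le> norm (smoothed_packet r j x)" unfolding conv_direction by (rule abs_Re_le_cmod)
    also have "\<dots> \<le> norm (\<kappa> * damping r j * cis (real j * x) / (80 - \<i> * x)\<^sup>2) + D * damping r j / (real j * (1 + x\<^sup>2))"
      using as[OF that, of x] norm_triangle_sub[of "smoothed_packet r j x"] by (meson add_left_mono order_trans)
    also have "norm (\<kappa> * damping r j * cis (real j * x) / (80 - \<i> * x)\<^sup>2) = \<kappa> * damping r j / (6400 + x\<^sup>2)"
      using \<kappa> damping_pos[OF that, of r] by (simp add: norm_divide norm_mult norm_power n)
    also have "\<dots> \<le> \<kappa> * damping r j / (1 + x\<^sup>2)"
      using \<kappa> damping_pos[OF that, of r] p[of x] by (intro frac_le) auto
    also have "D * damping r j / (real j * (1 + x\<^sup>2)) \<le> D * damping r j / (1 + x\<^sup>2)"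
      using D damping_pos[OF that, of r] p[of x] that by (intro frac_le) auto
    finally show ?thesis by (simp add: B_def add_divide_distrib distrib_right)
  qed
  show thesis
  proof
    show "a > 0" "b > 0" "j0 \<ge> 1"
      using \<kappa> D c by (auto simp: a_def b_def B_def j0_def intro!: mult_pos_pos divide_pos_pos)
    fix j assume j: "j \<ge> j0"
    then have j1: "j \<ge> 1" by (simp add: j0_def)
    let ?s = "damping r j"
    have s: "?s > 0" by (rule damping_pos[OF j1])
    have chi: "(?v j x)\<^sup>2 / base_density r x \<le> B\<^sup>2 / c * ?s\<^sup>2 * (1 / (1 + x\<^sup>2))" for x
    proof -
      have "(?v j x)\<^sup>2 \<le> (B * ?s / (1 + x\<^sup>2))\<^sup>2"
        using v_le[OF j1, of x] by (metis abs_ge_zero power2_abs power_mono)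
      then have "(?v j x)\<^sup>2 / base_density r x \<le> (B * ?s / (1 + x\<^sup>2))\<^sup>2 / (c / (1 + x\<^sup>2))"
        using c p[of x] by (intro frac_le) auto
      also have "\<dots> = B\<^sup>2 / c * ?s\<^sup>2 * (1 / (1 + x\<^sup>2))"
        using p[of x] c(1) by (simp add: power_divide power_mult_distrib power2_eq_square[of "1 + x\<^sup>2"] divide_simps)
      finally show ?thesis .
    qed
    have chi_bound: "integrable lborel (\<lambda>x. B\<^sup>2 / c * ?s\<^sup>2 * (1 / (1 + x\<^sup>2)))"
      by (intro integrable_mult_right lborel_integrable_Cauchy)
    show chi_int: "integrable lborel (\<lambda>x. (?v j x)\<^sup>2 / base_density r x)"
    proof (rule Bochner_Integration.integrable_bound[OF chi_bound])
      show "(\<lambda>x. (?v j x)\<^sup>2 / base_density r x) \<in> borel_measurable lborel"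
        using vi[of j] bi by (intro borel_measurable_divide borel_measurable_power) auto
      show "AE x in lborel. norm ((?v j x)\<^sup>2 / base_density r x) \<le> norm (B\<^sup>2 / c * ?s\<^sup>2 * (1 / (1 + x\<^sup>2)))"
        using bd order_trans[OF chi abs_ge_self] by (intro AE_I2) (simp add: abs_of_nonneg less_imp_le)
    qed
    have "(\<integral>x. (?v j x)\<^sup>2 / base_density r x \<partial>lborel) \<le> (\<integral>x. B\<^sup>2 / c * ?s\<^sup>2 * (1 / (1 + x\<^sup>2)) \<partial>lborel)"
      by (rule integral_mono[OF chi_int chi_bound chi])
    also have "\<dots> = b * ?s\<^sup>2"
      by (subst integral_mult_right_zero) (simp add: lborel_integral_Cauchy b_def)
    finally show "(\<integral>x. (?v j x)\<^sup>2 / base_density r x \<partial>lborel) \<le> b * ?s\<^sup>2" .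
    let ?k = "\<kappa> * ?s / 6400"
    have k: "?k > 0" using \<kappa> s by simp
    have err: "D * ?s / (real j * (1 + x\<^sup>2)) \<le> ?k / 8" for x :: real
    proof -
      have "51200 * D / \<kappa> \<le> real j" using j unfolding j0_def by linarith
      then have "D \<le> real j * (\<kappa> / 51200)" using \<kappa> by (simp add: field_simps)
      also have "\<dots> \<le> real j * (1 + x\<^sup>2) * (\<kappa> / 51200)"
        using \<kappa> by (intro mult_right_mono) (auto simp: distrib_left)
      finally have "D * ?s \<le> real j * (1 + x\<^sup>2) * (\<kappa> / 51200) * ?s"
        by (rule mult_right_mono) (use s in simp)
      then show ?thesis using j1 p[of x] by (simp add: pos_divide_le_eq mult_ac)
    qed
    have low: "?k * (cos (real j * x) * cos (real j * x) - 1 / 4) \<le> ?v j x * cos (real j * x)" if x: "\<bar>x\<bar> \<le> pi" for x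
    proof -
      have m: "\<kappa> * ?s * cis (real j * x) / (80 - \<i> * x)\<^sup>2 - ?k * cis (real j * x)
          = ?k * cis (real j * x) * (6400 / (80 - \<i> * x)\<^sup>2 - 1)"
        by (simp add: algebra_simps)
      have "norm (?k * cis (real j * x) * (6400 / (80 - \<i> * x)\<^sup>2 - 1)) \<le> ?k * (1 / 8)"
        using mult_left_mono[OF envelope_almost_constant[OF x] less_imp_le[OF k]]
        by (simp only: norm_mult norm_cis norm_of_real abs_of_pos[OF k] mult_1_right)
      moreover have "norm (smoothed_packet r j x - \<kappa> * ?s * cis (real j * x) / (80 - \<i> * x)\<^sup>2) \<le> ?k / 8"
        using as[OF j1, of x] err[of x] by linarith
      moreover have "norm (S - C) \<le> q / 4" if "norm (M - C) \<le> q * (1 / 8)" "norm (S - M) \<le> q / 8" for S M C :: complex and q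
        using norm_triangle_ineq[of "S - M" "M - C"] that by simp
      ultimately have "norm (smoothed_packet r j x - ?k * cis (real j * x)) \<le> ?k / 4"
        unfolding m[symmetric] by blast
      then have "\<bar>Re (smoothed_packet r j x - ?k * cis (real j * x))\<bar> \<le> ?k / 4"
        by (rule order_trans[OF abs_Re_le_cmod])
      then have d: "\<bar>?v j x - ?k * cos (real j * x)\<bar> \<le> ?k / 4" by (simp add: conv_direction)
      have "\<bar>(?v j x - ?k * cos (real j * x)) * cos (real j * x)\<bar> \<le> ?k / 4 * 1"
        unfolding abs_mult using \<kappa> s by (intro mult_mono d) auto
      then have "- (?k / 4) \<le> (?v j x - ?k * cos (real j * x)) * cos (real j * x)" by linarith
      then show ?thesis by (simp add: algebra_simps)
    qed
    let ?L = "\<lambda>x. ?k * sqrt pi * (trig j x * trig j x) - ?k / (4 * sqrt pi) * indicator {-pi..pi} x"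
    have L: "has_bochner_integral lborel ?L (?k * sqrt pi * 1 - ?k / (4 * sqrt pi) * (2 * pi))"
    proof (intro has_bochner_integral_diff has_bochner_integral_mult_right)
      show "has_bochner_integral lborel (\<lambda>x. trig j x * trig j x) 1"
        using j1 trig_orthonormal[of j j] by (simp add: has_bochner_integral_iff)
      have "has_bochner_integral lborel (indicator {-pi..pi} :: real \<Rightarrow> real) (measure lborel {-pi..pi})"
        by (rule has_bochner_integral_real_indicator) auto
      then show "has_bochner_integral lborel (indicator {-pi..pi} :: real \<Rightarrow> real) (2 * pi)" by simp
    qed
    have "a * ?s = ?k * sqrt pi - ?k / (4 * sqrt pi) * (2 * pi)"
    proof -
      have "pi / sqrt pi = sqrt pi" by (simp add: real_div_sqrt)
      then have "?k / (4 * sqrt pi) * (2 * pi) = ?k / 2 * sqrt pi" by (simp add: field_simps)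
      then show ?thesis by (simp add: a_def)
    qed
    also have "\<dots> = (\<integral>x. ?L x \<partial>lborel)"
      using has_bochner_integral_integral_eq[OF L] by simp
    also have "\<dots> \<le> (\<integral>x. ?v j x * trig j x \<partial>lborel)"
    proof (rule integral_mono[OF integrable.intros[OF L]])
      show "integrable lborel (\<lambda>x. ?v j x * trig j x)"
      proof (rule Bochner_Integration.integrable_bound[OF vi[of j]])
        show "(\<lambda>x. ?v j x * trig j x) \<in> borel_measurable lborel"
          using vi[of j] by (intro borel_measurable_times) auto
        show "AE x in lborel. norm (?v j x * trig j x) \<le> norm (?v j x)"
          using trig_bound by (intro AE_I2) (simp add: abs_mult mult_left_le)
      qed
      fix x :: real
      show "?L x \<le> ?v j x * trig j x"
      proof (cases "\<bar>x\<bar> \<le> pi")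
        case True
        then have i: "indicator {-pi..pi} x = (1 :: real)" by (auto simp: indicator_def)
        have "q * (c / q * (c / q)) = c * c / q" if "q \<noteq> 0" for c q :: real
          using that by (simp add: field_simps)
        from this[of "sqrt pi" "cos (real j * x)"]
        have "sqrt pi * (trig j x * trig j x) = cos (real j * x) * cos (real j * x) / sqrt pi"
          unfolding trig_def i by simp
        then have "?L x = ?k * (cos (real j * x) * cos (real j * x) - 1 / 4) / sqrt pi"
          using i by (simp add: mult.assoc diff_divide_distrib right_diff_distrib)
        also have "\<dots> \<le> ?v j x * cos (real j * x) / sqrt pi"
          by (intro divide_right_mono low True) simp
        also have "\<dots> = ?v j x * trig j x" using i by (simp add: trig_def)
        finally show ?thesis .
      next
        case False
        then have "indicator {-pi..pi} x = (0 :: real)" by (auto simp: indicator_def)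
        then show ?thesis by (simp add: trig_def)
      qed
    qed
    finally show "(\<integral>x. ?v j x * trig j x \<partial>lborel) \<ge> a * ?s" .
  qed
qed

section \<open>Rescaling and the choice of the cutoff frequency\<close>

definition dilate :: "real \<Rightarrow> (real \<Rightarrow> real) \<Rightarrow> real \<Rightarrow> real" where
  "dilate \<nu> f x = \<nu> * f (\<nu> * x)"

lemma integral_rescaled:
  fixes f :: "real \<Rightarrow> real"
  assumes "\<nu> > 0"
  shows "\<nu> * (\<integral>x. f (\<nu> * x) \<partial>lborel) = (\<integral>x. f x \<partial>lborel)"
  using lborel_integral_real_affine[of \<nu> f 0] assms by simp

lemma integrable_rescaled:
  fixes f :: "real \<Rightarrow> real"
  assumes "\<nu> > 0" "integrable lborel f"
  shows "integrable lborel (\<lambda>x. f (\<nu> * x))"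
  using lborel_integrable_real_affine[of f \<nu> 0] assms by simp

lemma
  assumes "\<nu> > 0" "integrable lborel f"
  shows integrable_dilate: "integrable lborel (dilate \<nu> f)"
    and integral_dilate: "(\<integral>x. dilate \<nu> f x \<partial>lborel) = (\<integral>x. f x \<partial>lborel)"
proof -
  show "integrable lborel (dilate \<nu> f)"
    unfolding dilate_def[abs_def] by (rule integrable_mult_right[OF integrable_rescaled[OF assms]])
  show "(\<integral>x. dilate \<nu> f x \<partial>lborel) = (\<integral>x. f x \<partial>lborel)"
    unfolding dilate_def integral_mult_right_zero by (rule integral_rescaled[OF assms(1)])
qed

lemma dilate_measurable[measurable]:
  assumes [measurable]: "f \<in> borel_measurable borel"
  shows "dilate \<nu> f \<in> borel_measurable borel"
  unfolding dilate_def[abs_def] by measurable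

text \<open>
  Dilating kernel and mixing density simultaneously dilates the mixture. The chi-square norms do not
  change, and the coefficients against \<open>L2\<close>-normalised test functions gain a factor \<open>sqrt \<nu>\<close> per
  coordinate, whose square accounts for the factor \<open>\<nu>^d\<close> of the theorem.
\<close>

lemma conv_dilate:
  assumes "\<nu> > 0"
  shows "conv (dilate \<nu> K) (dilate \<nu> g) x = dilate \<nu> (conv K g) x"
proof -
  have "conv (dilate \<nu> K) (dilate \<nu> g) x = \<nu> * (\<nu> * (\<integral>\<mu>. K (\<nu> * x - \<nu> * \<mu>) * g (\<nu> * \<mu>) \<partial>lborel))"
    by (simp add: conv_def dilate_def right_diff_distrib mult_ac)
  then show ?thesis
    using integral_rescaled[OF assms, of "\<lambda>m. K (\<nu> * x - m) * g m"] by (simp add: dilate_def conv_def)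
qed

text \<open>
  The frequencies \<open>m < j \<le> 2 m\<close> are used: they are large enough for the asymptotics if
  \<open>m \<ge> j0\<close>, there are \<open>m\<close> of them, and \<open>damping r j\<close> is at least \<open>exp (- 2 m)\<close> for each.
\<close>

lemma finite_sample_bound:
  fixes r :: nat
  obtains a b :: real and j0 :: nat where "a > 0" "b > 0"
    "\<And>\<nu> n m. \<nu> > 0 \<Longrightarrow> n > 0 \<Longrightarrow> j0 \<le> m \<Longrightarrow>
      (real m * pi) ^ CARD('d) \<le> sqrt (real n) * (sqrt b * exp (- 2 * real m)) ^ CARD('d) / 2 \<Longrightarrow>
      ennreal (real m ^ CARD('d) * (\<nu> * a) ^ CARD('d) / (8 * real n))
        \<le> minimax_risk n (mixture_class (student_prod r :: real ^ 'd \<Rightarrow> real) \<nu>)"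
proof (rule one_dimensional_estimates[of r])
  fix a b :: real and j0 :: nat
  assume ab: "a > 0" "b > 0" "j0 \<ge> 1" and
    chi: "\<And>j. j \<ge> j0 \<Longrightarrow> integrable lborel (\<lambda>x. (conv (student r) (direction j) x)\<^sup>2 / base_density r x)"
    "\<And>j. j \<ge> j0 \<Longrightarrow> (\<integral>x. (conv (student r) (direction j) x)\<^sup>2 / base_density r x \<partial>lborel) \<le> b * (damping r j)\<^sup>2"
    and cor: "\<And>j. j \<ge> j0 \<Longrightarrow> (\<integral>x. conv (student r) (direction j) x * trig j x \<partial>lborel) \<ge> a * damping r j"
  have bd: "base_density r x > 0" for x
  proof (rule base_density_lower[of r])
    fix c assume c: "c > 0" "\<And>x. c / (1 + x\<^sup>2) \<le> base_density r x"
    have "1 + x\<^sup>2 > 0" by (intro add_pos_nonneg) auto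
    then have "0 < c / (1 + x\<^sup>2)" using c(1) by (rule divide_pos_pos[rotated])
    then show ?thesis using c(2)[of x] by linarith
  qed
  show thesis
  proof (rule that[of "a\<^sup>2 / b" b j0])
    show "a\<^sup>2 / b > 0" "b > 0" using ab by auto
    fix \<nu> :: real and n m :: nat
    assume \<nu>: "\<nu> > 0" and n: "n > 0" and m: "j0 \<le> m"
      and small: "(real m * pi) ^ CARD('d) \<le> sqrt (real n) * (sqrt b * exp (- 2 * real m)) ^ CARD('d) / 2"
    let ?I = "{m<..2 * m}"
    let ?e = "\<lambda>j x. sqrt \<nu> * trig j (\<nu> * x)"
    have I: "j \<ge> j0" "j > 0" "j \<ge> 1" "j \<le> 2 * m" if "j \<in> ?I" for j using that m ab(3) by auto
    have ee: "?e i x * ?e j x = dilate \<nu> (\<lambda>x. trig i x * trig j x) x" for i j x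
      using \<nu> by (simp add: dilate_def)
    have chi_eq: "(conv (dilate \<nu> (student r)) (dilate \<nu> (direction j)) x)\<^sup>2 / conv (dilate \<nu> (student r)) (dilate \<nu> (student 0)) x
        = dilate \<nu> (\<lambda>x. (conv (student r) (direction j) x)\<^sup>2 / base_density r x) x" for j x
      using \<nu> by (simp add: conv_dilate[OF \<nu>] dilate_def base_density_def power_mult_distrib power2_eq_square[of \<nu>])
    have "ennreal (real (card ?I) ^ CARD('d) * ((sqrt \<nu> * a)\<^sup>2 / b) ^ CARD('d) / (8 * real n))
      \<le> minimax_risk n (mixture_class (student_prod r :: real ^ 'd \<Rightarrow> real) \<nu>)"
    proof (rule tensor_minimax_bound[where K = "dilate \<nu> (student r)" and g = "dilate \<nu> (student 0)" and h = "\<lambda>j. dilate \<nu> (direction j)"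
          and e = ?e and \<sigma> = "damping r" and M = pi and s = "exp (- 2 * real m)" and B = "\<nu> * student_const r" and E = "sqrt \<nu>"])
      show "rescale (student_prod r :: real ^ 'd \<Rightarrow> real) \<nu> x = tensor (\<lambda>_. dilate \<nu> (student r)) x" for x
        by (simp add: rescale_def student_prod_def tensor_def dilate_def prod.distrib)
      show "finite ?I" "n > 0" using n by auto
      show "integrable lborel (dilate \<nu> (student r))" "(\<integral>x. dilate \<nu> (student r) x \<partial>lborel) = 1"
        "integrable lborel (dilate \<nu> (student 0))" "(\<integral>x. dilate \<nu> (student 0) x \<partial>lborel) = 1"
        using \<nu> integrable_student by (simp_all add: integrable_dilate integral_dilate integral_student)
      show "0 \<le> dilate \<nu> (student r) x" "0 \<le> dilate \<nu> (student 0) x" "dilate \<nu> (student r) x \<le> \<nu> * student_const r" for x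
        using \<nu> student_pos student_le by (simp_all add: dilate_def less_imp_le)
      show "dilate \<nu> (direction j) \<in> borel_measurable borel" "(\<integral>x. dilate \<nu> (direction j) x \<partial>lborel) = 0" for j
        using \<nu> integrable_direction by (simp_all add: integral_dilate integral_direction)
      show "\<bar>dilate \<nu> (direction j) x\<bar> \<le> pi * dilate \<nu> (student 0) x" for j x
        using mult_left_mono[OF direction_bound[of j "\<nu> * x"], of \<nu>] \<nu> by (simp add: dilate_def abs_mult mult_ac)
      show "?e j \<in> borel_measurable borel" for j by measurable
      show "\<bar>?e j x\<bar> \<le> sqrt \<nu>" for j x
        using mult_left_mono[OF trig_bound[of j "\<nu> * x"], of "sqrt \<nu>"] \<nu> by (simp add: abs_mult)
      show "integrable lborel (\<lambda>x. ?e i x * ?e j x)" if "i \<in> ?I" "j \<in> ?I" for i j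
        unfolding ee using integrable_dilate[OF \<nu> trig_orthonormal(1)[OF I(2)[OF that(1)] I(2)[OF that(2)]]] by simp
      show "(\<integral>x. ?e i x * ?e j x \<partial>lborel) = (if i = j then 1 else 0)" if "i \<in> ?I" "j \<in> ?I" for i j
        unfolding ee using integral_dilate[OF \<nu> trig_orthonormal(1)[OF I(2)[OF that(1)] I(2)[OF that(2)]]]
          trig_orthonormal(2)[OF I(2)[OF that(1)] I(2)[OF that(2)]] by simp
      show "conv (dilate \<nu> (student r)) (dilate \<nu> (student 0)) x > 0" for x
        using \<nu> bd by (simp add: conv_dilate[OF \<nu>]) (simp add: dilate_def base_density_def)
      show "integrable lborel (\<lambda>x. (conv (dilate \<nu> (student r)) (dilate \<nu> (direction j)) x)\<^sup>2 / conv (dilate \<nu> (student r)) (dilate \<nu> (student 0)) x)"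
        "(\<integral>x. (conv (dilate \<nu> (student r)) (dilate \<nu> (direction j)) x)\<^sup>2 / conv (dilate \<nu> (student r)) (dilate \<nu> (student 0)) x \<partial>lborel)
          \<le> b * (damping r j)\<^sup>2" if "j \<in> ?I" for j
        unfolding chi_eq using integrable_dilate[OF \<nu> chi(1)[OF I(1)[OF that]]] integral_dilate[OF \<nu> chi(1)[OF I(1)[OF that]]]
          chi(2)[OF I(1)[OF that]] by simp_all
      show "(\<integral>x. conv (dilate \<nu> (student r)) (dilate \<nu> (direction j)) x * ?e j x \<partial>lborel) \<ge> sqrt \<nu> * a * damping r j" if "j \<in> ?I" for j
      proof -
        have "(\<integral>x. conv (dilate \<nu> (student r)) (dilate \<nu> (direction j)) x * ?e j x \<partial>lborel)
          = sqrt \<nu> * (\<nu> * (\<integral>x. conv (student r) (direction j) (\<nu> * x) * trig j (\<nu> * x) \<partial>lborel))"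
          unfolding integral_mult_right_zero[symmetric]
          by (rule Bochner_Integration.integral_cong[OF refl]) (simp add: conv_dilate[OF \<nu>], simp add: dilate_def mult_ac)
        also have "\<dots> = sqrt \<nu> * (\<integral>x. conv (student r) (direction j) x * trig j x \<partial>lborel)"
          using integral_rescaled[OF \<nu>, of "\<lambda>x. conv (student r) (direction j) x * trig j x"] by simp
        finally show ?thesis using mult_left_mono[OF cor[OF I(1)[OF that]], of "sqrt \<nu>"] \<nu> by (simp add: mult.assoc)
      qed
      show "sqrt \<nu> * a > 0" "b > 0" "exp (- 2 * real m) > 0" "pi \<ge> 0" using \<nu> ab by auto
      show "exp (- 2 * real m) \<le> damping r j" if "j \<in> ?I" for j
      proof -
        have "1 * exp (- 2 * real m) \<le> real j ^ r * exp (- real j)"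
          using I[OF that] by (intro mult_mono one_le_power) auto
        then show ?thesis by (simp add: damping_def)
      qed
      show "(real (card ?I) * pi) ^ CARD('d) \<le> sqrt (real n) * (sqrt b * exp (- 2 * real m)) ^ CARD('d) / 2"
        using small by simp
    qed
    also have "(sqrt \<nu> * a)\<^sup>2 / b = \<nu> * (a\<^sup>2 / b)" using \<nu> by (simp add: power_mult_distrib)
    finally show "ennreal (real m ^ CARD('d) * (\<nu> * (a\<^sup>2 / b)) ^ CARD('d) / (8 * real n))
        \<le> minimax_risk n (mixture_class (student_prod r :: real ^ 'd \<Rightarrow> real) \<nu>)" by simp
  qed
qed

text \<open>
  With \<open>m\<close> the integer part of \<open>ln n / (8 d)\<close>, the factor \<open>exp (- 2 m)^d\<close> costs at most
  \<open>n^(1/4)\<close>. The remaining \<open>n^(1/4)\<close> out of \<open>sqrt n\<close> beats the power of \<open>ln n\<close> on the left. Rounding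
  down loses less than a factor of two, hence the \<open>16\<close>.
\<close>

lemma eventually_log_cutoff:
  fixes b :: real and d j0 :: nat
  assumes b: "b > 0" and d: "d > 0"
  shows "\<forall>\<^sub>F n in sequentially. \<exists>m\<ge>j0. ln (real n) / (16 * real d) \<le> real m \<and>
    (real m * pi) ^ d \<le> sqrt (real n) * (sqrt b * exp (- 2 * real m)) ^ d / 2"
proof -
  have "((\<lambda>y::real. y ^ d / exp y) \<longlongrightarrow> 0) at_top" by (rule tendsto_power_div_exp_0)
  then have t: "\<forall>\<^sub>F y in at_top. y ^ d / exp y < (2 * real d * sqrt b / pi) ^ d / 2 \<and> y \<ge> 4 * real d * (real j0 + 2)"
    using b d by (intro eventually_conj order_tendstoD(2) eventually_ge_at_top) (auto intro!: divide_pos_pos zero_less_power mult_pos_pos)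
  have "filterlim (\<lambda>n. ln (real n) / 4) at_top sequentially" by real_asymp
  from eventually_compose_filterlim[OF t this] eventually_gt_at_top[of 0]
  show ?thesis
  proof eventually_elim
    case (elim n)
    \<comment> \<open>\<open>exp y\<close> is \<open>n^(1/4)\<close>\<close>
    define y where "y = ln (real n) / 4"
    define z where "z = y / (2 * real d)"
    define m where "m = nat \<lfloor>z\<rfloor>"
    have n: "real n > 0" using elim by simp
    have y: "y ^ d / exp y < (2 * real d * sqrt b / pi) ^ d / 2" "y \<ge> 4 * real d * (real j0 + 2)"
      using elim by (auto simp: y_def)
    have z: "z \<ge> 2 * (real j0 + 2)" using y(2) d by (simp add: z_def field_simps)
    have m: "real m \<le> z" "z < real m + 1"
    proof -
      have "real m = of_int \<lfloor>z\<rfloor>" unfolding m_def using z by simp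
      then show "real m \<le> z" "z < real m + 1" by linarith+
    qed
    have j0: "0 \<le> real j0" by simp
    have "real j0 \<le> real m" using m z j0 unfolding distrib_left by linarith
    then have 1: "m \<ge> j0" by simp
    have "z / 2 \<le> real m" using m z j0 unfolding distrib_left by linarith
    then have 2: "ln (real n) / (16 * real d) \<le> real m" by (simp add: y_def z_def)
    have "(real m * pi) ^ d \<le> (y / (2 * real d) * pi) ^ d"
      using m by (intro power_mono mult_right_mono) (auto simp: z_def)
    also have "\<dots> = y ^ d * (pi / (2 * real d)) ^ d"
      by (simp add: power_mult_distrib power_divide)
    also have "\<dots> \<le> exp y * ((2 * real d * sqrt b / pi) ^ d / 2) * (pi / (2 * real d)) ^ d"
      using y(1) by (intro mult_right_mono) (auto simp: divide_less_eq mult.commute less_imp_le)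
    also have "\<dots> = exp y * sqrt b ^ d / 2"
      using d by (simp add: power_mult_distrib power_divide)
    also have "exp y \<le> sqrt (real n) * exp (- 2 * real m) ^ d"
    proof -
      have "2 * real m * real d \<le> y" using m(1) d by (simp add: z_def field_simps)
      then have "y \<le> 2 * y - 2 * real m * real d" by simp
      then have "exp y \<le> exp (2 * y) * exp (- (2 * real m * real d))"
        by (simp flip: exp_add)
      also have "exp (2 * y) = sqrt (real n)"
        using n by (simp add: y_def ln_sqrt[symmetric] flip: ln_sqrt)
      also have "exp (- (2 * real m * real d)) = exp (- 2 * real m) ^ d"
        by (simp add: exp_of_nat_mult[symmetric] mult_ac)
      finally show ?thesis .
    qed
    finally have 3: "(real m * pi) ^ d \<le> sqrt (real n) * (sqrt b * exp (- 2 * real m)) ^ d / 2"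
      using b by (simp add: power_mult_distrib mult_ac mult_right_mono)
    from 1 2 3 show ?case by blast
  qed
qed

theorem theorem20:
  fixes r :: nat
  shows "\<exists>\<kappa>>0. \<forall>\<nu>>0. \<forall>\<^sub>F n in sequentially.
    minimax_risk n (mixture_class (student_prod r :: real ^ 'd \<Rightarrow> real) \<nu>)
      \<ge> ennreal (\<kappa> * \<nu> ^ CARD('d) * (ln (real n) ^ CARD('d) / real n))"
proof (rule finite_sample_bound[where 'd = 'd and r = r])
  let ?d = "CARD('d)"
  fix a b :: real and j0 :: nat
  assume ab: "a > 0" "b > 0" and bound:
    "\<And>\<nu> n m. \<nu> > 0 \<Longrightarrow> n > 0 \<Longrightarrow> j0 \<le> m \<Longrightarrow>
      (real m * pi) ^ ?d \<le> sqrt (real n) * (sqrt b * exp (- 2 * real m)) ^ ?d / 2 \<Longrightarrow>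
      ennreal (real m ^ ?d * (\<nu> * a) ^ ?d / (8 * real n))
        \<le> minimax_risk n (mixture_class (student_prod r :: real ^ 'd \<Rightarrow> real) \<nu>)"
  define \<kappa> where "\<kappa> = (a / (16 * real ?d)) ^ ?d / 8"
  show ?thesis
  proof (intro exI[of _ \<kappa>] conjI allI impI)
    show "\<kappa> > 0" using ab by (simp add: \<kappa>_def)
    fix \<nu> :: real assume \<nu>: "\<nu> > 0"
    have "?d > 0" by simp
    from eventually_log_cutoff[OF ab(2) this, of j0] eventually_gt_at_top[of 0]
    show "\<forall>\<^sub>F n in sequentially. minimax_risk n (mixture_class (student_prod r :: real ^ 'd \<Rightarrow> real) \<nu>)
      \<ge> ennreal (\<kappa> * \<nu> ^ ?d * (ln (real n) ^ ?d / real n))"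
    proof eventually_elim
      case (elim n)
      then obtain m where m: "m \<ge> j0" "ln (real n) / (16 * real ?d) \<le> real m"
        "(real m * pi) ^ ?d \<le> sqrt (real n) * (sqrt b * exp (- 2 * real m)) ^ ?d / 2" by blast
      have n: "n > 0" using elim by simp
      have "\<kappa> * \<nu> ^ ?d * (ln (real n) ^ ?d / real n)
          = (ln (real n) / (16 * real ?d)) ^ ?d * (\<nu> * a) ^ ?d / (8 * real n)"
        by (simp add: \<kappa>_def power_divide power_mult_distrib mult_ac)
      also have "\<dots> \<le> real m ^ ?d * (\<nu> * a) ^ ?d / (8 * real n)"
        using m(2) \<nu> ab n by (intro divide_right_mono mult_right_mono power_mono) auto
      finally show ?case
        by (rule order_trans[OF ennreal_leI bound[OF \<nu> n m(1,3)]])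
    qed
  qed
qed

end
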